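(* Let $H_N$ be the rescaled discrete PNG height process (defined in the context, for a fixed parameter $0<q<1$) and let $$K_N=\inf\{u\,:\,\sup_{t\le u}H_N(t)=\sup_{t}H_N(t)\}.$$ The sequence of random variables $\{K_N\}_{N\ge1}$ is tight, i.e. given $\epsilon>0$ there are a $T>0$ and an $N_0$ such that $\mathbb{P}[|K_N|>T]<\epsilon$ for all $N\ge N_0$.
   Context: Fix $0<q<1$. Let $w(i,j)$, $i,j\ge1$, be independent geometric random variables, $\mathbb{P}[w(i,j)=m]=(1-q)q^m$, $m\ge0$. Define $G(i,j)$ by $G(i,0)=G(0,j)=0$ and $G(i,j)=\max(G(i-1,j),G(i,j-1))+w(i,j)$ for $i,j\ge1$; equivalently $G(M,N)=\max_\pi\sum_{(i,j)\in\pi}w(i,j)$ over all up/right lattice paths $\pi$ from $(1,1)$ to $(M,N)$. Let $d=\dfrac{(\sqrt q)^{1/3}(1+\sqrt q)^{1/3}}{1-\sqrt q}$. The rescaled process $H_N$ is defined by $$G(N+u,N-u)=\frac{2\sqrt q}{1-\sqrt q}N+dN^{1/3}H_N\Big(\frac{1-\sqrt q}{1+\sqrt q}\,d\,u\,N^{-2/3}\Big)$$ for integers $|u|<N$, and by linear interpolation between these points. Suprema of $H_N$ are taken over the interval on which $H_N$ is so defined; $K_N$ is the leftmost point of maximum of $H_N$. *)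

theory Defs
  imports "HOL-Probability.Probability"
begin

text \<open>Last passage times are defined for a fixed realisation \<open>w\<close> of the weights. Only the
  values \<open>w i j\<close> with \<open>i, j \<ge> 1\<close> are used.\<close>

fun G :: "(nat \<Rightarrow> nat \<Rightarrow> nat) \<Rightarrow> nat \<Rightarrow> nat \<Rightarrow> nat" where
  "G w 0 j = 0"
| "G w (Suc i) 0 = 0"
| "G w (Suc i) (Suc j) = max (G w i (Suc j)) (G w (Suc i) j) + w (Suc i) (Suc j)"

definition d_const :: "real \<Rightarrow> real" where
  "d_const q = sqrt q powr (1/3) * (1 + sqrt q) powr (1/3) / (1 - sqrt q)"

definition mesh :: "real \<Rightarrow> nat \<Rightarrow> real" where
  "mesh q N = (1 - sqrt q) / (1 + sqrt q) * d_const q * real N powr (- 2/3)"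

text \<open>The value of \<open>H\<^sub>N\<close> at the point \<open>mesh q N * u\<close>, for an integer \<open>u\<close> with \<open>\<bar>u\<bar> < N\<close>;
  see \<open>G_eq_H\<close> below.\<close>

definition H_node :: "real \<Rightarrow> (nat \<Rightarrow> nat \<Rightarrow> nat) \<Rightarrow> nat \<Rightarrow> int \<Rightarrow> real" where
  "H_node q w N u =
     (real (G w (nat (int N + u)) (nat (int N - u))) - 2 * sqrt q / (1 - sqrt q) * real N)
       / (d_const q * real N powr (1/3))"

text \<open>The interval on which \<open>H\<^sub>N\<close> is defined: from the node \<open>u = -(N - 1)\<close> to \<open>u = N - 1\<close>.\<close>

definition H_dom :: "real \<Rightarrow> nat \<Rightarrow> real set" where
  "H_dom q N = {- (mesh q N * (real N - 1)) .. mesh q N * (real N - 1)}"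

text \<open>Linear interpolation between consecutive nodes; meaningful on \<open>H_dom q N\<close> only. At the right
  end point the weight of the (irrelevant) node \<open>u = N\<close> is \<open>0\<close>.\<close>

definition H :: "real \<Rightarrow> (nat \<Rightarrow> nat \<Rightarrow> nat) \<Rightarrow> nat \<Rightarrow> real \<Rightarrow> real" where
  "H q w N t =
     (let x = t / mesh q N
      in (1 - frac x) * H_node q w N \<lfloor>x\<rfloor> + frac x * H_node q w N (\<lfloor>x\<rfloor> + 1))"

definition K :: "real \<Rightarrow> (nat \<Rightarrow> nat \<Rightarrow> nat) \<Rightarrow> nat \<Rightarrow> real" where
  "K q w N =
     Inf {u \<in> H_dom q N. (SUP t \<in> {t \<in> H_dom q N. t \<le> u}. H q w N t) = (SUP t \<in> H_dom q N. H q w N t)}"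

lemma d_const_pos:
  assumes "0 < q" "q < 1"
  shows "0 < d_const q"
proof -
  have "0 < sqrt q" "sqrt q < 1" "0 < 1 + sqrt q"
    using assms by (auto intro: add_pos_pos)
  then show ?thesis
    unfolding d_const_def by (intro divide_pos_pos mult_pos_pos) auto
qed

lemma mesh_pos:
  assumes "0 < q" "q < 1" "0 < N"
  shows "0 < mesh q N"
proof -
  have "0 < 1 - sqrt q" "0 < 1 + sqrt q"
    using assms by (auto intro: add_pos_pos)
  then show ?thesis
    unfolding mesh_def using assms d_const_pos[of q]
    by (intro mult_pos_pos divide_pos_pos) auto
qed

lemma G_eq_H:
  fixes u :: int
  assumes "0 < q" "q < 1" "\<bar>u\<bar> < int N"
  shows "real (G w (nat (int N + u)) (nat (int N - u))) =
     2 * sqrt q / (1 - sqrt q) * real N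
       + d_const q * real N powr (1/3)
         * H q w N ((1 - sqrt q) / (1 + sqrt q) * d_const q * of_int u * real N powr (- 2/3))"
proof -
  have N: "0 < N" using assms(3) by linarith
  have "(1 - sqrt q) / (1 + sqrt q) * d_const q * of_int u * real N powr (- 2/3) = of_int u * mesh q N"
    by (simp add: mesh_def)
  moreover have "H q w N (of_int u * mesh q N) = H_node q w N u"
    using mesh_pos[OF assms(1,2) N] by (simp add: H_def Let_def)
  ultimately show ?thesis
    using N d_const_pos[OF assms(1,2)] by (simp add: H_node_def)
qed

end

theory Submission
  imports Defs
begin

text \<open>
  Compare with a stationary model: give the axes independent geometric weights of parameters
  \<open>a = r * exp (- s)\<close> and \<open>b = r * exp s\<close>, where \<open>r = sqrt q\<close>. By the Burke property, the passage times of this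
  model along the antidiagonal form a random walk, whose steps have negative drift of order \<open>- s\<close>. If the
  optimal path to a point \<open>x\<close> leaves the origin along the bottom axis, then to the right of \<open>x\<close> the increments
  of \<open>G\<close> are bounded by those of the walk, so a little further right \<open>G\<close> stays below its value at \<open>x\<close>.
  With \<open>s\<close> of order \<open>\<tau> * N powr (-1/3)\<close> and \<open>x\<close> at distance of order \<open>\<tau> * N powr (2/3)\<close> from the diagonal,
  beyond the characteristic direction of the stationary model, this fails with probability \<open>O(1 / \<tau>)\<close>.

  The exit along the bottom axis rests on exact exponential moments: if the passage time has parameters
  \<open>r * exp (- s1)\<close> and \<open>r * exp s2\<close>, then its exponential moment at \<open>s1 - s2\<close> is
  \<open>exp (\<Phi> s1 - \<Phi> s2)\<close>. They bound upper tails on the scale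
  \<open>N powr (1/3)\<close>, and as the mean \<open>\<Phi>' s\<close> of the stationary passage time is known exactly, they also bound its
  lower tail. A path leaving along the left axis is typically shorter by a larger amount.
\<close>

section \<open>Last passage times with boundary weights\<close>

text \<open>Row and column 0 carry the boundary weights, so interior sites keep the indices used by
  \<open>G\<close>; the origin contributes 0.\<close>

fun LP :: "(nat \<times> nat \<Rightarrow> nat) \<Rightarrow> nat \<Rightarrow> nat \<Rightarrow> nat" where
  "LP c 0 0 = 0"
| "LP c (Suc i) 0 = LP c i 0 + c (Suc i, 0)"
| "LP c 0 (Suc j) = LP c 0 j + c (0, Suc j)"
| "LP c (Suc i) (Suc j) = max (LP c i (Suc j)) (LP c (Suc i) j) + c (Suc i, Suc j)"

definition hor :: "(nat \<times> nat \<Rightarrow> nat) \<Rightarrow> nat \<Rightarrow> nat \<Rightarrow> nat" where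
  "hor c i j = LP c (Suc i) j - LP c i j"

definition ver :: "(nat \<times> nat \<Rightarrow> nat) \<Rightarrow> nat \<Rightarrow> nat \<Rightarrow> nat" where
  "ver c i j = LP c i (Suc j) - LP c i j"

text \<open>\<open>LP\<close> is monotone in both coordinates, so the truncated subtractions in
  \<open>hor\<close> and \<open>ver\<close> are true differences.\<close>

lemma LP_Suc_left: "LP c (Suc i) j = LP c i j + hor c i j"
  unfolding hor_def by (cases j) auto

lemma LP_Suc_right: "LP c i (Suc j) = LP c i j + ver c i j"
  unfolding ver_def by (cases i) auto

lemma hor_0: "hor c i 0 = c (Suc i, 0)"
  by (simp add: hor_def)

lemma ver_0: "ver c 0 j = c (0, Suc j)"
  by (simp add: ver_def)

text \<open>Subtracting \<open>LP c i (Suc j)\<close> turns the maximum in the recursion into the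
  positive part of \<open>hor - ver\<close>, which truncated subtraction expresses: a Lindley
  recursion, as for waiting times in queues.\<close>

lemma hor_Suc: "hor c i (Suc j) = c (Suc i, Suc j) + (hor c i j - ver c i j)"
  using LP_Suc_left[of c i j] LP_Suc_right[of c i j]
  by (simp add: hor_def[of c i "Suc j"] max_def add.commute add.left_commute)

lemma ver_Suc: "ver c (Suc i) j = c (Suc i, Suc j) + (ver c i j - hor c i j)"
  using LP_Suc_left[of c i j] LP_Suc_right[of c i j]
  by (simp add: ver_def[of c "Suc i" j] max_def add.commute add.left_commute)

lemma LP_cong:
  assumes "\<And>x y. x \<le> i \<Longrightarrow> y \<le> j \<Longrightarrow> (x, y) \<noteq> (0, 0) \<Longrightarrow> c (x, y) = c' (x, y)"
  shows "LP c i j = LP c' i j"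
  using assms by (induction c i j rule: LP.induct) auto

lemma LP_bottom: "LP c m 0 = (\<Sum>i<m. c (Suc i, 0))"
  by (induction m) auto

lemma LP_eq_bottom_plus_right: "LP c m n = (\<Sum>i<m. c (Suc i, 0)) + (\<Sum>j<n. ver c m j)"
  by (induction n) (auto simp: LP_bottom LP_Suc_right)

section \<open>Decomposition by the axis along which a path leaves the origin\<close>

definition no_bottom :: "(nat \<times> nat \<Rightarrow> nat) \<Rightarrow> nat \<times> nat \<Rightarrow> nat" where
  "no_bottom c = (\<lambda>x. if snd x = 0 then 0 else c x)"

definition no_left :: "(nat \<times> nat \<Rightarrow> nat) \<Rightarrow> nat \<times> nat \<Rightarrow> nat" where
  "no_left c = (\<lambda>x. if fst x = 0 then 0 else c x)"

lemma LP_no_bottom_0: "LP (no_bottom c) i 0 = 0"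
  by (induction i) (auto simp: no_bottom_def)

lemma LP_no_left_0: "LP (no_left c) 0 j = 0"
  by (induction j) (auto simp: no_left_def)

text \<open>A path leaves the origin along one axis and does not return to the other. Thus
  \<open>no_bottom\<close> stands for the exits along the left axis and \<open>no_left\<close> for
  those along the bottom axis.\<close>

lemma LP_max: "LP c i j = max (LP (no_bottom c) i j) (LP (no_left c) i j)"
  by (induction c i j rule: LP.induct)
    (auto simp: LP_no_bottom_0 LP_no_left_0, auto simp: no_bottom_def no_left_def)

lemma LP_no_bottom_le: "LP (no_bottom c) i j \<le> LP c i j"
  unfolding LP_max[of c i j] by simp

lemma LP_no_left_le: "LP (no_left c) i j \<le> LP c i j"
  unfolding LP_max[of c i j] by simp

lemma LP_no_boundary: "LP (no_bottom (no_left c)) i j = G (\<lambda>i j. c (i, j)) i j"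
proof (induction c i j rule: LP.induct)
  case (2 c i)
  then show ?case by (cases i) (auto simp: no_bottom_def no_left_def)
next
  case (3 c j)
  then show ?case by (cases j) (auto simp: no_bottom_def no_left_def)
qed (auto simp: no_bottom_def no_left_def)

text \<open>Each recursion increases in one of the two increments and decreases in the other, so the
  two opposite comparisons are carried together through the induction.\<close>

lemma hor_ver_mono:
  assumes "\<And>i j. c (Suc i, Suc j) = c' (Suc i, Suc j)"
    and "\<And>i. c (Suc i, 0) \<le> c' (Suc i, 0)" and "\<And>j. c' (0, Suc j) \<le> c (0, Suc j)"
  shows "hor c i j \<le> hor c' i j \<and> ver c' i j \<le> ver c i j"
proof (induction "i + j" arbitrary: i j rule: less_induct)
  case less
  have 1: "hor c i j \<le> hor c' i j"
  proof (cases j)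
    case (Suc k)
    with less[of i k] show ?thesis by (auto simp: hor_Suc assms(1))
  qed (simp add: hor_0 assms)
  have 2: "ver c' i j \<le> ver c i j"
  proof (cases i)
    case (Suc k)
    with less[of k j] show ?thesis by (auto simp: ver_Suc assms(1))
  qed (simp add: ver_0 assms)
  from 1 2 show ?case by blast
qed

text \<open>The axis slots of a state act as registers: \<open>(Suc i, 0)\<close> for a horizontal
  step from column \<open>i\<close>, \<open>(0, Suc j)\<close> for a vertical step from row
  \<open>j\<close>. Each term is one step right minus one step down along an antidiagonal.\<close>

definition walk :: "(nat \<times> nat \<Rightarrow> nat) \<Rightarrow> nat \<Rightarrow> nat \<Rightarrow> nat \<Rightarrow> int" where
  "walk s x y k = (\<Sum>i<k. int (s (Suc (x + i), 0)) - int (s (0, y - i)))"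

text \<open>A step down is followed by a step right, so the increments sit at the inner corners
  \<open>(x + i, y - Suc i)\<close> of the staircase.\<close>

lemma LP_antidiagonal:
  assumes "k \<le> y"
  shows "int (LP c (x + k) (y - k)) - int (LP c x y) =
    (\<Sum>i<k. int (hor c (x + i) (y - Suc i)) - int (ver c (x + i) (y - Suc i)))"
  using assms
proof (induction k)
  case (Suc k)
  have "y - k = Suc (y - Suc k)" using Suc.prems by simp
  then have "LP c (x + k) (y - k) = LP c (x + k) (y - Suc k) + ver c (x + k) (y - Suc k)"
    by (simp add: LP_Suc_right)
  moreover have "LP c (x + Suc k) (y - Suc k) = LP c (x + k) (y - Suc k) + hor c (x + k) (y - Suc k)"
    by (simp add: LP_Suc_left)
  ultimately show ?case using Suc by simp
qed simp

text \<open>Removing the bottom boundary of \<open>no_left c\<close> can only decrease increments in the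
  down-right direction, and \<open>LP\<close> dominates \<open>LP (no_left c)\<close>; so equality at the starting
  point suffices for the comparison.\<close>

lemma G_antidiagonal_le:
  assumes "k \<le> y" and "LP (no_bottom c) x y \<le> LP (no_left c) x y"
  shows "int (G (\<lambda>i j. c (i, j)) (x + k) (y - k)) - int (G (\<lambda>i j. c (i, j)) x y)
    \<le> int (LP c (x + k) (y - k)) - int (LP c x y)"
proof -
  let ?b = "no_bottom (no_left c)"
  have mono: "hor ?b i j \<le> hor (no_left c) i j \<and> ver (no_left c) i j \<le> ver ?b i j" for i j
    by (rule hor_ver_mono) (auto simp: no_bottom_def no_left_def)
  have "int (LP ?b (x + k) (y - k)) - int (LP ?b x y)
    \<le> int (LP (no_left c) (x + k) (y - k)) - int (LP (no_left c) x y)"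
    unfolding LP_antidiagonal[OF assms(1)] by (rule sum_mono) (use mono in \<open>auto intro: diff_mono\<close>)
  moreover have "LP c x y = LP (no_left c) x y" using assms(2) LP_max[of c x y] by simp
  moreover have "LP (no_left c) (x + k) (y - k) \<le> LP c (x + k) (y - k)" by (simp add: LP_max[of c])
  ultimately show ?thesis by (simp add: LP_no_boundary)
qed

section \<open>The Burke property\<close>

text \<open>The local move of the Burke property: the increments on the lower and left sides of a
  cell are replaced by those on its upper and right sides. Storing the minimum of the old increments
  in place of the consumed weight makes the move reversible.\<close>

definition flip :: "nat \<Rightarrow> nat \<Rightarrow> (nat \<times> nat \<Rightarrow> nat) \<Rightarrow> nat \<times> nat \<Rightarrow> nat" where
  "flip i j s = s((Suc i, 0) := s (Suc i, Suc j) + (s (Suc i, 0) - s (0, Suc j)),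
                  (0, Suc j) := s (Suc i, Suc j) + (s (0, Suc j) - s (Suc i, 0)),
                  (Suc i, Suc j) := min (s (Suc i, 0)) (s (0, Suc j)))"

text \<open>One of the two truncated differences is 0, so the smaller new increment is the old
  weight, while the difference of the increments is unchanged.\<close>

lemma flip_flip: "flip i j (flip i j s) = s"
  by (rule ext) (auto simp: flip_def min_def)

text \<open>The state \<open>s\<close> stores the increments of \<open>LP c\<close> along the down-right path with column
  heights \<open>h\<close> and row lengths \<open>l\<close>, and the unused weights of \<open>c\<close> above that path.\<close>

definition encodes ::
  "(nat \<times> nat \<Rightarrow> nat) \<Rightarrow> (nat \<Rightarrow> nat) \<Rightarrow> (nat \<Rightarrow> nat) \<Rightarrow> (nat \<times> nat \<Rightarrow> nat) \<Rightarrow> bool" where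
  "encodes c h l s \<longleftrightarrow> (\<forall>i. s (Suc i, 0) = hor c i (h i)) \<and> (\<forall>j. s (0, Suc j) = ver c (l j) j) \<and>
     (\<forall>i j. h i \<le> j \<longrightarrow> s (Suc i, Suc j) = c (Suc i, Suc j))"

text \<open>The conditions \<open>h i = j\<close> and \<open>l j = i\<close> say that the cell is an
  inner corner of the path, so its two increments and its weight are all stored; the recursions for
  \<open>hor\<close> and \<open>ver\<close> give the increments on its far sides.\<close>

lemma encodes_flip:
  assumes "encodes c h l s" "h i = j" "l j = i"
  shows "encodes c (h(i := Suc j)) (l(j := Suc i)) (flip i j s)"
  using assms unfolding encodes_def flip_def by (auto simp: hor_Suc ver_Suc)

section \<open>The product law of the weights and its invariance under flips\<close>

definition grid :: "nat \<Rightarrow> nat \<Rightarrow> (nat \<times> nat) set" where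
  "grid m n = {..m} \<times> {..n} - {(0, 0)}"

lemma finite_grid [simp]: "finite (grid m n)"
  by (simp add: grid_def)

text \<open>\<open>geometric_pmf\<close> takes the success probability; the parameters
  \<open>q\<close>, \<open>a\<close>, \<open>b\<close> are the ratios of successive point
  probabilities.\<close>

definition site :: "real \<Rightarrow> real \<Rightarrow> real \<Rightarrow> nat \<times> nat \<Rightarrow> nat pmf" where
  "site q a b x = geometric_pmf (1 - (if snd x = 0 then a else if fst x = 0 then b else q))"

definition law :: "real \<Rightarrow> real \<Rightarrow> real \<Rightarrow> (nat \<times> nat) set \<Rightarrow> (nat \<times> nat \<Rightarrow> nat) pmf" where
  "law q a b F = Pi_pmf F 0 (site q a b)"

text \<open>As \<open>flip\<close> is an involution, the image law at \<open>y\<close> is the old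
  law at \<open>flip i j y\<close>. Only the three factors of the cell change, and their normalising
  constants cancel.\<close>

lemma map_flip_law:
  assumes "0 < a" "a < 1" "0 < b" "b < 1" "q = a * b" and "i < m" "j < n"
  shows "map_pmf (flip i j) (law q a b (grid m n)) = law q a b (grid m n)"
proof (rule pmf_eqI)
  fix y
  let ?F = "grid m n" and ?T = "{(Suc i, 0), (0, Suc j), (Suc i, Suc j)}"
  have q: "0 < q" "q < 1" using assms(1-5) mult_strict_mono[of a 1 b 1] by auto
  have T: "?T \<subseteq> ?F" using assms(6,7) by (auto simp: grid_def)
  have "inj (flip i j)" by (metis flip_flip injI)
  then have "pmf (map_pmf (flip i j) (law q a b ?F)) y = pmf (law q a b ?F) (flip i j y)"
    using pmf_map_inj'[of "flip i j" "law q a b ?F" "flip i j y"] by (simp add: flip_flip)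
  also have "\<dots> = pmf (law q a b ?F) y"
  proof -
    have out: "flip i j y x = y x" if "x \<notin> ?T" for x
      using that by (auto simp: flip_def)
    let ?p = "\<lambda>y x. pmf (site q a b x) (y x)"
    have "prod (?p (flip i j y)) ?F = prod (?p (flip i j y)) (?F - ?T) * prod (?p (flip i j y)) ?T"
      by (rule prod.subset_diff[OF T]) simp
    also have "prod (?p (flip i j y)) (?F - ?T) = prod (?p y) (?F - ?T)"
      by (intro prod.cong) (auto simp: out)
    also have "prod (?p (flip i j y)) ?T = prod (?p y) ?T"
    proof -
      define u v w where "u = y (Suc i, 0)" and "v = y (0, Suc j)" and "w = y (Suc i, Suc j)"
      \<comment> \<open>This balance of exponents is where \<open>q = a * b\<close> enters: the
        powers of \<open>a\<close> and of \<open>b\<close> agree separately.\<close>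
      have "a ^ (w + (u - v)) * b ^ (w + (v - u)) * (a * b) ^ min u v = a ^ u * b ^ v * (a * b) ^ w"
      proof (cases "u \<le> v")
        case True
        then obtain d where "v = u + d" using le_Suc_ex by blast
        then show ?thesis by (simp add: power_mult_distrib power_add algebra_simps)
      next
        case False
        then obtain d where "u = v + d" using le_Suc_ex nle_le by blast
        then show ?thesis by (simp add: power_mult_distrib power_add algebra_simps)
      qed
      then show ?thesis
        using assms(1-4) q by (simp add: flip_def site_def u_def v_def w_def assms(5))
    qed
    also have "prod (?p y) (?F - ?T) * prod (?p y) ?T = prod (?p y) ?F"
      by (rule prod.subset_diff[OF T, symmetric]) simp
    finally have "prod (?p (flip i j y)) ?F = prod (?p y) ?F" .
    moreover have "(\<forall>x. x \<notin> ?F \<longrightarrow> flip i j y x = 0) \<longleftrightarrow> (\<forall>x. x \<notin> ?F \<longrightarrow> y x = 0)"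
      using T out by (metis subsetD)
    ultimately show ?thesis by (simp only: law_def pmf_Pi[OF finite_grid])
  qed
  finally show "pmf (map_pmf (flip i j) (law q a b ?F)) y = pmf (law q a b ?F) y" .
qed

text \<open>The Burke property of a down-right path: its increments and the weights above it jointly
  have the law of the original weights. The map \<open>f\<close>, a composition of flips in the
  constructions below, is chosen before \<open>a\<close> and \<open>b\<close>.\<close>

definition reachable :: "nat \<Rightarrow> nat \<Rightarrow> (nat \<Rightarrow> nat) \<Rightarrow> (nat \<Rightarrow> nat) \<Rightarrow> bool" where
  "reachable m n h l \<longleftrightarrow> (\<exists>f. (\<forall>c. encodes c h l (f c)) \<and>
     (\<forall>a b. 0 < a \<longrightarrow> a < 1 \<longrightarrow> 0 < b \<longrightarrow> b < 1 \<longrightarrow>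
        map_pmf f (law (a * b) a b (grid m n)) = law (a * b) a b (grid m n)))"

lemma reachable_0: "reachable m n (\<lambda>_. 0) (\<lambda>_. 0)"
  unfolding reachable_def by (intro exI[of _ id]) (auto simp: encodes_def hor_0 ver_0)

lemma reachable_step:
  assumes "reachable m n h l" "h i = j" "l j = i" "i < m" "j < n"
  shows "reachable m n (h(i := Suc j)) (l(j := Suc i))"
proof -
  from assms(1) obtain f where f: "\<And>c. encodes c h l (f c)"
    "\<And>a b. 0 < a \<Longrightarrow> a < 1 \<Longrightarrow> 0 < b \<Longrightarrow> b < 1 \<Longrightarrow>
        map_pmf f (law (a * b) a b (grid m n)) = law (a * b) a b (grid m n)"
    unfolding reachable_def by blast
  have "map_pmf (flip i j \<circ> f) (law (a * b) a b (grid m n)) = law (a * b) a b (grid m n)"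
    if "0 < a" "a < 1" "0 < b" "b < 1" for a b
    using f(2)[OF that] map_flip_law[OF that refl assms(4,5)] by (simp add: pmf.map_comp[symmetric])
  then show ?thesis
    unfolding reachable_def using encodes_flip[of _ h l _ i j] f(1) assms(2,3)
    by (intro exI[of _ "flip i j \<circ> f"]) auto
qed

text \<open>Cells are appended to column \<open>i\<close> from the bottom up; \<open>l j = i\<close>
  makes each of them an inner corner when its turn comes.\<close>

lemma reachable_column:
  assumes "reachable m n h l" "h i = 0" "\<And>j. j < k \<Longrightarrow> l j = i" "i < m" "k \<le> n"
  shows "reachable m n (h(i := k)) (\<lambda>j. if j < k then Suc i else l j)"
  using assms(3,5)
proof (induction k)
  case 0
  with assms(1,2) show ?case by (simp add: fun_upd_idem)
next
  case (Suc k)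
  have "reachable m n ((h(i := k))(i := Suc k)) ((\<lambda>j. if j < k then Suc i else l j)(k := Suc i))"
  proof (rule reachable_step)
    show "reachable m n (h(i := k)) (\<lambda>j. if j < k then Suc i else l j)"
      using Suc.IH Suc.prems by (simp add: fun_upd_def)
  qed (use Suc.prems assms(4) in auto)
  moreover have "(\<lambda>j. if j < k then Suc i else l j)(k := Suc i) = (\<lambda>j. if j < Suc k then Suc i else l j)"
    by (auto simp: fun_eq_iff)
  ultimately show ?case by (simp only: fun_upd_upd)
qed

lemma reachable_rectangle:
  "k \<le> m \<Longrightarrow> reachable m n (\<lambda>i. if i < k then n else 0) (\<lambda>j. if j < n then k else 0)"
proof (induction k)
  case 0
  then show ?case using reachable_0 by simp
next
  case (Suc k)
  let ?h = "\<lambda>k i. if i < k then n else 0"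
  have "reachable m n ((?h k)(k := n)) (\<lambda>j. if j < n then Suc k else (if j < n then k else 0))"
    using Suc by (intro reachable_column) auto
  moreover have "(?h k)(k := n) = ?h (Suc k)" by (auto simp: fun_eq_iff)
  moreover have "(\<lambda>j. if j < n then Suc k else (if j < n then k else 0)) = (\<lambda>j. if j < n then Suc k else 0)"
    by auto
  ultimately show ?case by simp
qed

text \<open>Columns of height \<open>m - i\<close> leave as upper boundary the staircase with
  corners on \<open>x + y = m\<close>, just inside the antidiagonal
  \<open>x + y = Suc m\<close>.\<close>

lemma reachable_triangle:
  "k \<le> m \<Longrightarrow> reachable m m (\<lambda>i. if i < k then m - i else 0) (\<lambda>j. min k (m - j))"
proof (induction k)
  case 0
  then show ?case using reachable_0 by simp
next
  case (Suc k)
  let ?h = "\<lambda>k i. if i < k then m - i else 0"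
  have "reachable m m ((?h k)(k := m - k)) (\<lambda>j. if j < m - k then Suc k else min k (m - j))"
    using Suc by (intro reachable_column) auto
  moreover have "(?h k)(k := m - k) = ?h (Suc k)" by (auto simp: fun_eq_iff)
  moreover have "(\<lambda>j. if j < m - k then Suc k else min k (m - j)) = (\<lambda>j. min (Suc k) (m - j))"
    by (auto simp: fun_eq_iff)
  ultimately show ?case by simp
qed

lemma burke_right:
  obtains f where "\<And>c j. j < n \<Longrightarrow> f c (0, Suc j) = ver c m j"
    and "\<And>a b. 0 < a \<Longrightarrow> a < 1 \<Longrightarrow> 0 < b \<Longrightarrow> b < 1 \<Longrightarrow>
        map_pmf f (law (a * b) a b (grid m n)) = law (a * b) a b (grid m n)"
proof -
  obtain f where f: "\<And>c. encodes c (\<lambda>i. if i < m then n else 0) (\<lambda>j. if j < n then m else 0) (f c)"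
    "\<And>a b. 0 < a \<Longrightarrow> a < 1 \<Longrightarrow> 0 < b \<Longrightarrow> b < 1 \<Longrightarrow>
        map_pmf f (law (a * b) a b (grid m n)) = law (a * b) a b (grid m n)"
    using reachable_rectangle[of m m n] unfolding reachable_def by auto
  have "f c (0, Suc j) = ver c m j" if "j < n" for c j
    using f(1)[of c] that unfolding encodes_def by simp
  with f(2) that show ?thesis by blast
qed

lemma burke_antidiagonal:
  obtains f where "\<And>c x y k. x + y = Suc m \<Longrightarrow> k \<le> y \<Longrightarrow>
      walk (f c) x y k = int (LP c (x + k) (y - k)) - int (LP c x y)"
    and "\<And>a b. 0 < a \<Longrightarrow> a < 1 \<Longrightarrow> 0 < b \<Longrightarrow> b < 1 \<Longrightarrow>
        map_pmf f (law (a * b) a b (grid m m)) = law (a * b) a b (grid m m)"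
proof -
  obtain f where f: "\<And>c. encodes c (\<lambda>i. if i < m then m - i else 0) (\<lambda>j. min m (m - j)) (f c)"
    "\<And>a b. 0 < a \<Longrightarrow> a < 1 \<Longrightarrow> 0 < b \<Longrightarrow> b < 1 \<Longrightarrow>
        map_pmf f (law (a * b) a b (grid m m)) = law (a * b) a b (grid m m)"
    using reachable_triangle[of m m] unfolding reachable_def by auto
  have "walk (f c) x y k = int (LP c (x + k) (y - k)) - int (LP c x y)"
    if xy: "x + y = Suc m" and k: "k \<le> y" for c x y k
    unfolding LP_antidiagonal[OF k] walk_def
  proof (rule sum.cong[OF refl])
    fix i assume "i \<in> {..<k}"
    then have i: "i < k" by simp
    then have "0 < y - i" using k by simp
    then have y: "(0, y - i) = (0, Suc (y - Suc i))" using i k by simp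
    have "f c (Suc (x + i), 0) = hor c (x + i) (if x + i < m then m - (x + i) else 0)"
      using f(1)[of c] unfolding encodes_def by simp
    \<comment> \<open>Here \<open>x + i \<le> m\<close>, and in the extreme case
      \<open>x + i = m\<close> both sides are 0.\<close>
    also have "(if x + i < m then m - (x + i) else 0) = y - Suc i"
      using xy i k by auto
    finally have 1: "f c (Suc (x + i), 0) = hor c (x + i) (y - Suc i)" .
    have "f c (0, y - i) = ver c (min m (m - (y - Suc i))) (y - Suc i)"
      unfolding y using f(1)[of c] unfolding encodes_def by blast
    also have "min m (m - (y - Suc i)) = x + i" using xy i k by auto
    finally show "int (f c (Suc (x + i), 0)) - int (f c (0, y - i)) =
      int (hor c (x + i) (y - Suc i)) - int (ver c (x + i) (y - Suc i))" using 1 by simp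
  qed
  with f(2) that show ?thesis by blast
qed

section \<open>Exponential moments\<close>

lemma nn_integral_geometric_power:
  assumes "0 < a" "a < 1" "0 \<le> z" "a * z < 1"
  shows "(\<integral>\<^sup>+k. ennreal (z ^ k) \<partial>geometric_pmf (1 - a)) = ennreal ((1 - a) / (1 - a * z))"
proof -
  have "(\<lambda>k. (a * z) ^ k) sums (1 / (1 - a * z))"
    using assms by (intro geometric_sums) (auto simp: abs_mult)
  then have "(\<lambda>k. (1 - a) * (a * z) ^ k) sums ((1 - a) * (1 / (1 - a * z)))"
    by (rule sums_mult)
  then have s: "(\<lambda>k. a ^ k * (1 - a) * z ^ k) sums ((1 - a) / (1 - a * z))"
    by (simp add: power_mult_distrib mult_ac)
  have "(\<integral>\<^sup>+k. ennreal (z ^ k) \<partial>geometric_pmf (1 - a)) = (\<Sum>k. ennreal (a ^ k * (1 - a) * z ^ k))"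
    using assms by (simp add: nn_integral_measure_pmf nn_integral_count_space_nat ennreal_mult)
  also have "\<dots> = ennreal (\<Sum>k. a ^ k * (1 - a) * z ^ k)"
    using s assms by (intro suminf_ennreal2) (auto simp: sums_iff)
  finally show ?thesis using s by (simp add: sums_iff)
qed

section \<open>Erasing weights from the product law\<close>

lemma law_subset:
  assumes "finite F" "F' \<subseteq> F"
  shows "law q a b F' = map_pmf (\<lambda>c x. if x \<in> F' then c x else 0) (law q a b F)"
  unfolding law_def by (rule Pi_pmf_subset[OF assms])

lemma law_zero:
  assumes "finite F"
  shows "map_pmf (\<lambda>c x. if x \<in> Z then 0 else c x) (law q a b F) = law q a b (F - Z)"
proof -
  have "law q a b (F - Z) = map_pmf (\<lambda>c x. if x \<in> F - Z then c x else 0) (law q a b F)"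
    by (rule law_subset) (use assms in auto)
  also have "\<dots> = map_pmf (\<lambda>c x. if x \<in> Z then 0 else c x) (law q a b F)"
  proof (rule map_pmf_cong[OF refl])
    fix c assume "c \<in> set_pmf (law q a b F)"
    from subsetD[OF set_Pi_pmf_subset[OF assms] this[unfolded law_def]]
    have *: "c x = 0" if "x \<notin> F" for x
      using that by (cases x) simp
    show "(\<lambda>x. if x \<in> F - Z then c x else 0) = (\<lambda>x. if x \<in> Z then 0 else c x)"
    proof
      fix x
      show "(if x \<in> F - Z then c x else 0) = (if x \<in> Z then 0 else c x)"
        using *[of x] by (cases "x \<in> F") auto
    qed
  qed
  finally show ?thesis by simp
qed

lemma law_no_bottom:
  "map_pmf no_bottom (law q a b (grid m n)) = law q a b (grid m n - {x. snd x = 0})"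
  using law_zero[OF finite_grid, of "{x. snd x = 0}"] by (simp add: no_bottom_def[abs_def])

lemma law_no_left:
  "map_pmf no_left (law q a b (grid m n)) = law q a b (grid m n - {x. fst x = 0})"
  using law_zero[OF finite_grid, of "{x. fst x = 0}"] by (simp add: no_left_def[abs_def])

text \<open>Once an axis is erased its parameter is free. This freedom is what makes the exponential
  moments of each exit accessible from those of the full model.\<close>

lemma no_bottom_indep: "map_pmf no_bottom (law q a b (grid m n)) = map_pmf no_bottom (law q a' b (grid m n))"
  unfolding law_no_bottom unfolding law_def by (rule Pi_pmf_cong) (auto simp: site_def)

lemma no_left_indep: "map_pmf no_left (law q a b (grid m n)) = map_pmf no_left (law q a b' (grid m n))"
  unfolding law_no_left unfolding law_def by (rule Pi_pmf_cong) (auto simp: site_def)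

section \<open>Tilting the bottom axis\<close>

definition bottom :: "nat \<Rightarrow> (nat \<times> nat) set" where
  "bottom m = (\<lambda>i. (Suc i, 0)) ` {..<m}"

lemma sum_bottom: "(\<Sum>x\<in>bottom m. c x) = (\<Sum>i<m. c (Suc i, 0))"
  unfolding bottom_def by (subst sum.reindex) (auto simp: inj_on_def)

lemma card_bottom: "card (bottom m) = m"
  unfolding bottom_def by (subst card_image) (auto simp: inj_on_def)

text \<open>The likelihood ratio for a change of the bottom parameter: only the \<open>m\<close>
  bottom factors of the product depend on it.\<close>

lemma pmf_law_tilt:
  assumes "0 < a" "a < 1" "0 < a'" "a' < 1"
  shows "pmf (law q a' b (grid m n)) c =
    pmf (law q a b (grid m n)) c * (((1 - a') / (1 - a)) ^ m * (a' / a) ^ (\<Sum>i<m. c (Suc i, 0)))"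
proof (cases "\<forall>x. x \<notin> grid m n \<longrightarrow> c x = 0")
  case True
  let ?F = "grid m n" and ?B = "bottom m"
  have B: "?B \<subseteq> ?F" by (auto simp: bottom_def grid_def)
  have split: "(\<Prod>x\<in>?F. f x) = (\<Prod>x\<in>?F - ?B. f x) * (\<Prod>x\<in>?B. f x)" for f :: "_ \<Rightarrow> real"
    by (rule prod.subset_diff[OF B]) simp
  have 1: "(\<Prod>x\<in>?F - ?B. pmf (site q a' b x) (c x)) = (\<Prod>x\<in>?F - ?B. pmf (site q a b x) (c x))"
  proof (rule prod.cong[OF refl])
    fix x assume "x \<in> ?F - ?B"
    then have "snd x \<noteq> 0" by (cases x, cases "fst x") (auto simp: bottom_def grid_def)
    then show "pmf (site q a' b x) (c x) = pmf (site q a b x) (c x)" by (simp add: site_def)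
  qed
  have "(\<Prod>x\<in>?B. pmf (site q a' b x) (c x)) =
    (\<Prod>x\<in>?B. pmf (site q a b x) (c x) * ((1 - a') / (1 - a) * (a' / a) ^ c x))"
    using assms by (intro prod.cong) (auto simp: bottom_def site_def power_divide)
  also have "\<dots> = (\<Prod>x\<in>?B. pmf (site q a b x) (c x)) *
      (((1 - a') / (1 - a)) ^ m * (a' / a) ^ (\<Sum>i<m. c (Suc i, 0)))"
    by (simp only: prod.distrib prod_constant card_bottom power_sum sum_bottom[symmetric])
  finally have 2: "(\<Prod>x\<in>?B. pmf (site q a' b x) (c x)) = \<dots>" .
  show ?thesis
    using True by (simp add: law_def pmf_Pi split 1 2)
next
  case False
  then show ?thesis by (simp only: law_def pmf_Pi[OF finite_grid] if_False mult_zero_left)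
qed

lemma nn_integral_prod_law:
  assumes "finite F" "S \<subseteq> F"
  shows "(\<integral>\<^sup>+c. (\<Prod>x\<in>S. f (c x)) \<partial>law q a b F) = (\<Prod>x\<in>S. \<integral>\<^sup>+k. f k \<partial>site q a b x)"
proof -
  have fS: "finite S" using assms finite_subset by blast
  have "(\<Prod>x\<in>S. \<integral>\<^sup>+k. f k \<partial>site q a b x) = (\<integral>\<^sup>+c. (\<Prod>x\<in>S. f (c x)) \<partial>law q a b S)"
    unfolding law_def by (rule nn_integral_prod_Pi_pmf[OF fS, symmetric])
  also have "\<dots> = (\<integral>\<^sup>+c. (\<Prod>x\<in>S. f (c x)) \<partial>law q a b F)"
    unfolding law_subset[OF assms] by (simp cong: prod.cong)
  finally show ?thesis by simp
qed

definition left :: "nat \<Rightarrow> (nat \<times> nat) set" where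
  "left n = (\<lambda>j. (0, Suc j)) ` {..<n}"

lemma sum_left: "(\<Sum>x\<in>left n. c x) = (\<Sum>j<n. c (0, Suc j))"
  unfolding left_def by (subst sum.reindex) (auto simp: inj_on_def)

lemma card_left: "card (left n) = n"
  unfolding left_def by (subst card_image) (auto simp: inj_on_def)

text \<open>Tilting the bottom parameter from \<open>a\<close> to the stationary value \<open>q / b\<close> replaces the exponential
  moment of \<open>LP\<close>, the sum of the bottom and right increments, by that of the right increments
  alone, which the Burke property makes explicit.\<close>

lemma nn_integral_LP:
  assumes "0 < q" "q < a" "a < 1" "q < b" "b < 1"
  shows "(\<integral>\<^sup>+c. ennreal ((q / (a * b)) ^ LP c m n) \<partial>law q a b (grid m n)) =
    ennreal (((1 - a) / (1 - q / b)) ^ m * ((1 - b) / (1 - q / a)) ^ n)"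
proof -
  \<comment> \<open>\<open>a0\<close> makes the model with \<open>b\<close> stationary, and
    \<open>z = a0 / a\<close> is the base for which the likelihood ratio cancels the contribution
    \<open>z ^ S\<close> of the bottom weights.\<close>
  define a0 z where "a0 = q / b" and "z = q / (a * b)"
  have a0: "0 < a0" "a0 < 1" and z: "0 < z" and qa: "q = a0 * b" and za: "a / a0 = 1 / z" and bz: "b * z = q / a" "q / a < 1"
    using assms by (auto simp: a0_def z_def field_simps)
  let ?g = "grid m n"
  obtain f where f: "\<And>c j. j < n \<Longrightarrow> f c (0, Suc j) = ver c m j"
    "map_pmf f (law q a0 b ?g) = law q a0 b ?g"
    using burke_right[of n m] a0 assms(1,4,5) unfolding qa by (metis order.strict_trans)
  define C where "C = ((1 - a) / (1 - a0)) ^ m"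
  have C: "0 \<le> C" unfolding C_def using a0 assms by simp
  have "(\<integral>\<^sup>+c. ennreal (z ^ LP c m n) \<partial>law q a b ?g) =
    (\<integral>\<^sup>+c. ennreal (pmf (law q a0 b ?g) c) * (ennreal C * ennreal (z ^ (\<Sum>j<n. ver c m j))) \<partial>count_space UNIV)"
    unfolding nn_integral_measure_pmf
  proof (rule nn_integral_cong)
    fix c
    define S R where "S = (\<Sum>i<m. c (Suc i, 0))" and "R = (\<Sum>j<n. ver c m j)"
    have "pmf (law q a b ?g) c * z ^ LP c m n = pmf (law q a0 b ?g) c * (C * (1 / z) ^ S) * z ^ (S + R)"
      unfolding S_def R_def C_def LP_eq_bottom_plus_right[symmetric] za[symmetric]
      by (subst pmf_law_tilt[where a = a0]) (use a0 assms in auto)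
    also have "\<dots> = pmf (law q a0 b ?g) c * (C * z ^ R)"
      using z by (simp add: power_add power_one_over field_simps)
    finally have "pmf (law q a b ?g) c * z ^ LP c m n = pmf (law q a0 b ?g) c * (C * z ^ R)" .
    then show "ennreal (pmf (law q a b ?g) c) * ennreal (z ^ LP c m n) =
        ennreal (pmf (law q a0 b ?g) c) * (ennreal C * ennreal (z ^ R))"
      using C z by (simp add: ennreal_mult[symmetric])
  qed
  also have "\<dots> = ennreal C * (\<integral>\<^sup>+c. ennreal (z ^ (\<Sum>j<n. ver c m j)) \<partial>law q a0 b ?g)"
    unfolding nn_integral_measure_pmf
    by (subst nn_integral_cmult[symmetric]) (auto intro!: nn_integral_cong simp: mult_ac)
  also have "(\<integral>\<^sup>+c. ennreal (z ^ (\<Sum>j<n. ver c m j)) \<partial>law q a0 b ?g) =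
      (\<integral>\<^sup>+c. ennreal (z ^ (\<Sum>j<n. f c (0, Suc j))) \<partial>law q a0 b ?g)"
    by (simp add: f(1))
  also have "\<dots> = (\<integral>\<^sup>+c. ennreal (z ^ (\<Sum>j<n. c (0, Suc j))) \<partial>map_pmf f (law q a0 b ?g))"
    by simp
  also have "\<dots> = (\<integral>\<^sup>+c. (\<Prod>x\<in>left n. ennreal (z ^ c x)) \<partial>law q a0 b ?g)"
    unfolding f(2) sum_left[symmetric] power_sum using z by (simp add: prod_ennreal)
  also have "\<dots> = (\<Prod>x\<in>left n. \<integral>\<^sup>+k. ennreal (z ^ k) \<partial>site q a0 b x)"
    by (rule nn_integral_prod_law) (auto simp: left_def grid_def)
  also have "\<dots> = (\<Prod>x\<in>left n. ennreal ((1 - b) / (1 - q / a)))"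
    unfolding bz(1)[symmetric]
    by (intro prod.cong refl, auto simp: left_def site_def, rule nn_integral_geometric_power)
      (use assms z bz in auto)
  also have "\<dots> = ennreal (((1 - b) / (1 - q / a)) ^ n)"
    using bz assms by (simp add: card_left ennreal_power)
  finally show ?thesis
    unfolding z_def[symmetric] using C bz assms by (simp add: ennreal_mult[symmetric] C_def a0_def)
qed

section \<open>Mean of the stationary passage time and moments of one walk step\<close>

lemma geometric_mean:
  assumes "0 < a" "a < 1"
  shows "integrable (measure_pmf (geometric_pmf (1 - a))) real"
    and "measure_pmf.expectation (geometric_pmf (1 - a)) real = a / (1 - a)"
  using assms integrable_real_geometric_pmf[of "1 - a"] expectation_geometric_pmf[of "1 - a"] by auto

lemma law_component:
  assumes "finite F" "x \<in> F"
  shows "map_pmf (\<lambda>c. c x) (law q a b F) = site q a b x"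
  unfolding law_def using assms by (simp add: Pi_pmf_component)

text \<open>By linearity the mean is a sum over the bottom weights and the increments up the right
  side; the latter are geometric with parameter \<open>b\<close> by the Burke property.\<close>

lemma expectation_LP:
  assumes "0 < a" "a < 1" "0 < b" "b < 1"
  shows "integrable (measure_pmf (law (a * b) a b (grid m n))) (\<lambda>c. real (LP c m n))" (is ?i)
    and "measure_pmf.expectation (law (a * b) a b (grid m n)) (\<lambda>c. real (LP c m n)) =
      real m * (a / (1 - a)) + real n * (b / (1 - b))" (is ?e)
proof -
  let ?p = "law (a * b) a b (grid m n)"
  obtain f where f: "\<And>c j. j < n \<Longrightarrow> f c (0, Suc j) = ver c m j" "map_pmf f ?p = ?p"
    using burke_right[of n m] assms by metis
  have comp: "integrable (measure_pmf ?p) (\<lambda>c. g (c x)) \<longleftrightarrow> integrable (measure_pmf (site (a * b) a b x)) g"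
    "measure_pmf.expectation ?p (\<lambda>c. g (c x)) = measure_pmf.expectation (site (a * b) a b x) g"
    if "x \<in> grid m n" for x and g :: "nat \<Rightarrow> real"
    unfolding law_component[OF finite_grid that, symmetric] by simp_all
  have A: "integrable (measure_pmf ?p) (\<lambda>c. real (c (Suc i, 0)))"
    "measure_pmf.expectation ?p (\<lambda>c. real (c (Suc i, 0))) = a / (1 - a)" if "i < m" for i
    using comp[of "(Suc i, 0)" real] geometric_mean[OF assms(1,2)] that
    by (auto simp: site_def grid_def)
  have B: "integrable (measure_pmf ?p) (\<lambda>c. real (ver c m j))"
    "measure_pmf.expectation ?p (\<lambda>c. real (ver c m j)) = b / (1 - b)" if "j < n" for j
  proof -
    have *: "integrable (measure_pmf ?p) (\<lambda>c. real (c (0, Suc j)))"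
      "measure_pmf.expectation ?p (\<lambda>c. real (c (0, Suc j))) = b / (1 - b)"
      using comp[of "(0, Suc j)" real] geometric_mean[OF assms(3,4)] that
      by (auto simp: site_def grid_def)
    have "integrable (measure_pmf (map_pmf f ?p)) (\<lambda>c. real (c (0, Suc j)))"
      "measure_pmf.expectation (map_pmf f ?p) (\<lambda>c. real (c (0, Suc j))) = b / (1 - b)"
      unfolding f(2) by (rule *)+
    then show "integrable (measure_pmf ?p) (\<lambda>c. real (ver c m j))"
      "measure_pmf.expectation ?p (\<lambda>c. real (ver c m j)) = b / (1 - b)"
      by (simp_all add: f(1)[OF that])
  qed
  have S: "integrable (measure_pmf ?p) (\<lambda>c. \<Sum>i<m. real (c (Suc i, 0)))"
    "integrable (measure_pmf ?p) (\<lambda>c. \<Sum>j<n. real (ver c m j))"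
    using A(1) B(1) by auto
  have LP: "(\<lambda>c. real (LP c m n)) = (\<lambda>c. (\<Sum>i<m. real (c (Suc i, 0))) + (\<Sum>j<n. real (ver c m j)))"
    by (simp add: LP_eq_bottom_plus_right)
  show ?i unfolding LP using S by simp
  show ?e unfolding LP
    by (subst Bochner_Integration.integral_add[OF S], subst (1 2) Bochner_Integration.integral_sum)
      (use A B in auto)
qed

text \<open>The moment factor of one walk step. It equals 1 at \<open>z = b / a\<close>, and at the
  square root of this value it is the decay factor of the walk.\<close>

lemma nn_integral_step:
  assumes "0 < a" "a < 1" "0 < b" "b < 1" "0 < z" "a * z < 1" "b < z"
  shows "(\<integral>\<^sup>+x. (\<integral>\<^sup>+y. ennreal (z powi (int x - int y)) \<partial>geometric_pmf (1 - b)) \<partial>geometric_pmf (1 - a)) =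
    ennreal ((1 - a) / (1 - a * z) * ((1 - b) / (1 - b / z)))"
proof -
  have "(\<integral>\<^sup>+x. (\<integral>\<^sup>+y. ennreal (z powi (int x - int y)) \<partial>geometric_pmf (1 - b)) \<partial>geometric_pmf (1 - a)) =
    (\<integral>\<^sup>+x. (\<integral>\<^sup>+y. ennreal (z ^ x) * ennreal ((1 / z) ^ y) \<partial>geometric_pmf (1 - b)) \<partial>geometric_pmf (1 - a))"
    using assms by (intro nn_integral_cong) (simp add: power_int_diff ennreal_mult[symmetric] power_one_over)
  also have "\<dots> = (\<integral>\<^sup>+x. ennreal (z ^ x) \<partial>geometric_pmf (1 - a)) * (\<integral>\<^sup>+y. ennreal ((1 / z) ^ y) \<partial>geometric_pmf (1 - b))"
    by (simp add: nn_integral_cmult nn_integral_multc)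
  also have "\<dots> = ennreal ((1 - a) / (1 - a * z)) * ennreal ((1 - b) / (1 - b * (1 / z)))"
    using assms by (simp add: nn_integral_geometric_power)
  finally show ?thesis using assms by (simp add: ennreal_mult[symmetric])
qed

section \<open>A random walk with negative drift\<close>

definition step_sum :: "nat \<Rightarrow> nat \<Rightarrow> nat \<Rightarrow> nat \<Rightarrow> (nat \<times> nat \<Rightarrow> nat) \<Rightarrow> int" where
  "step_sum x y j k s = (\<Sum>i\<in>{j..<k}. int (s (Suc (x + i), 0)) - int (s (0, y - i)))"

definition slots :: "nat \<Rightarrow> nat \<Rightarrow> nat \<Rightarrow> nat \<Rightarrow> (nat \<times> nat) set" where
  "slots x y j k = (\<lambda>i. (Suc (x + i), 0)) ` {j..<k} \<union> (\<lambda>i. (0, y - i)) ` {j..<k}"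

text \<open>The start \<open>j\<close> and the level \<open>l\<close> are kept variable so that
  splitting off one step leads to an event of the same kind, ready for induction backwards in
  \<open>j\<close>.\<close>

definition crossing :: "nat \<Rightarrow> nat \<Rightarrow> nat \<Rightarrow> nat \<Rightarrow> nat \<Rightarrow> int \<Rightarrow> (nat \<times> nat \<Rightarrow> nat) set" where
  "crossing x y k0 n j l = {s. \<exists>k. j \<le> k \<and> k0 \<le> k \<and> k \<le> n \<and> l \<le> step_sum x y j k s}"

text \<open>The two weights of step \<open>j\<close> are independent of the later slots. Integrating
  over them shifts the level by the step, so a bound exponential in the level is multiplied by the
  moment factor of one step.\<close>

lemma emeasure_crossing_step:
  assumes "j < n" "n \<le> y"
    and "0 < a" "a < 1" "0 < b" "b < 1" "0 < z" "a * z < 1" "b < z" "0 \<le> C"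
    and bound: "\<And>l. emeasure (law q a b (slots x y (Suc j) n)) (crossing x y k0 n (Suc j) l)
      \<le> ennreal (C * z powi (- l))"
  shows "emeasure (law q a b (slots x y j n))
      {s. s \<in> crossing x y k0 n (Suc j) (l - (int (s (Suc (x + j), 0)) - int (s (0, y - j))))}
      \<le> ennreal (C * z powi (- l) * ((1 - a) / (1 - a * z) * ((1 - b) / (1 - b / z))))"
proof -
  let ?u = "(Suc (x + j), 0)" and ?v = "(0, y - j)"
  let ?F = "slots x y (Suc j) n"
  let ?E = "\<lambda>l. crossing x y k0 n (Suc j) l"
  have jn: "{j..<n} = insert j {Suc j..<n}" using assms(1) by auto
  have F: "slots x y j n = insert ?u (insert ?v ?F)"
    unfolding slots_def jn by auto
  have finF: "finite ?F" by (simp add: slots_def)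
  \<comment> \<open>The bound \<open>n \<le> y\<close> keeps the row indices \<open>y - i\<close>
    positive and distinct, so step \<open>j\<close> uses fresh slots.\<close>
  have v: "?v \<notin> ?F" and u: "?u \<notin> insert ?v ?F" using assms(1,2) by (auto simp: slots_def)
  have upd: "f(?v := w', ?u := w) \<in> ?E l \<longleftrightarrow> f \<in> ?E l" for f :: "nat \<times> nat \<Rightarrow> nat" and w w' l
  proof -
    have "step_sum x y (Suc j) k (f(?v := w', ?u := w)) = step_sum x y (Suc j) k f" if "k \<le> n" for k
      unfolding step_sum_def
      by (rule sum.cong[OF refl]) (use that assms(1,2) in auto)
    then show ?thesis unfolding crossing_def by auto
  qed
  have sites: "site q a b ?u = geometric_pmf (1 - a)" "site q a b ?v = geometric_pmf (1 - b)"
    using assms(1,2) by (auto simp: site_def)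
  let ?A = "{s. s \<in> ?E (l - (int (s ?u) - int (s ?v)))}"
  have "emeasure (law q a b (slots x y j n)) ?A = (\<integral>\<^sup>+s. indicator ?A s \<partial>law q a b (slots x y j n))"
    by simp
  also have "\<dots> = (\<integral>\<^sup>+w. \<integral>\<^sup>+w'. \<integral>\<^sup>+f. indicator ?A (f(?v := w', ?u := w)) \<partial>law q a b ?F
      \<partial>geometric_pmf (1 - b) \<partial>geometric_pmf (1 - a))"
    unfolding F law_def
    by (subst Pi_pmf_insert'[OF _ u], simp add: finF, subst Pi_pmf_insert'[OF finF v])
      (simp add: sites nn_integral_bind_pmf)
  also have "\<dots> = (\<integral>\<^sup>+w. \<integral>\<^sup>+w'. emeasure (law q a b ?F) (?E (l - (int w - int w')))
      \<partial>geometric_pmf (1 - b) \<partial>geometric_pmf (1 - a))"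
  proof (intro nn_integral_cong)
    fix w w'
    have "indicator ?A (f(?v := w', ?u := w)) = (indicator (?E (l - (int w - int w'))) f :: ennreal)" for f
      using upd[of f w' w] by (simp add: indicator_def)
    then show "(\<integral>\<^sup>+f. indicator ?A (f(?v := w', ?u := w)) \<partial>law q a b ?F) =
        emeasure (law q a b ?F) (?E (l - (int w - int w')))" by simp
  qed
  also have "\<dots> \<le> (\<integral>\<^sup>+w. \<integral>\<^sup>+w'. ennreal (C * z powi (- l)) * ennreal (z powi (int w - int w'))
      \<partial>geometric_pmf (1 - b) \<partial>geometric_pmf (1 - a))"
  proof (intro nn_integral_mono)
    fix w w' :: nat
    have "z powi (- (l - (int w - int w'))) = z powi (- l) * z powi (int w - int w')"
      using assms(7) by (subst power_int_add[symmetric]) auto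
    then have "ennreal (C * z powi (- (l - (int w - int w')))) =
        ennreal (C * z powi (- l)) * ennreal (z powi (int w - int w'))"
      using assms(7,10) by (simp only: mult.assoc[symmetric]) (simp add: ennreal_mult[symmetric])
    then show "emeasure (law q a b ?F) (?E (l - (int w - int w'))) \<le>
        ennreal (C * z powi (- l)) * ennreal (z powi (int w - int w'))"
      using bound[of "l - (int w - int w')"] by (simp only:)
  qed
  also have "\<dots> = ennreal (C * z powi (- l)) *
      (\<integral>\<^sup>+w. \<integral>\<^sup>+w'. ennreal (z powi (int w - int w')) \<partial>geometric_pmf (1 - b) \<partial>geometric_pmf (1 - a))"
    by (simp add: nn_integral_cmult)
  also have "\<dots> = ennreal (C * z powi (- l) * ((1 - a) / (1 - a * z) * ((1 - b) / (1 - b / z))))"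
    using assms by (subst nn_integral_step) (auto simp: ennreal_mult[symmetric])
  finally show ?thesis .
qed

lemma crossing_Suc:
  assumes "j < n"
  shows "s \<in> crossing x y k0 n j l \<longleftrightarrow> (k0 \<le> j \<and> l \<le> 0) \<or>
    s \<in> crossing x y k0 n (Suc j) (l - (int (s (Suc (x + j), 0)) - int (s (0, y - j))))"
proof -
  have split: "step_sum x y j k s =
      (int (s (Suc (x + j), 0)) - int (s (0, y - j))) + step_sum x y (Suc j) k s" if "Suc j \<le> k" for k
    unfolding step_sum_def using that by (subst sum.atLeast_Suc_lessThan) auto
  have 0: "step_sum x y j j s = 0" by (simp add: step_sum_def)
  show ?thesis (is "?l \<longleftrightarrow> ?r")
  proof
    assume ?l
    then obtain k where k: "j \<le> k" "k0 \<le> k" "k \<le> n" "l \<le> step_sum x y j k s"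
      by (auto simp: crossing_def)
    then show ?r
      by (cases "k = j") (use 0 split[of k] in \<open>auto simp: crossing_def intro!: exI[of _ k]\<close>)
  next
    assume ?r
    then show ?l
    proof
      assume "k0 \<le> j \<and> l \<le> 0"
      then show ?l using 0 assms by (auto simp: crossing_def intro!: exI[of _ j])
    next
      assume "s \<in> crossing x y k0 n (Suc j) (l - (int (s (Suc (x + j), 0)) - int (s (0, y - j))))"
      then obtain k where "Suc j \<le> k" "k0 \<le> k" "k \<le> n"
        "l - (int (s (Suc (x + j), 0)) - int (s (0, y - j))) \<le> step_sum x y (Suc j) k s"
        by (auto simp: crossing_def)
      then show ?l using split[of k] by (auto simp: crossing_def intro!: exI[of _ k])
    qed
  qed
qed

text \<open>For a walk \<open>W\<close> with steps \<open>Geom(a) - Geom(b)\<close> the process \<open>(b / a) ^ W\<close> is a martingale.\<close>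

lemma emeasure_crossing_martingale:
  assumes "n \<le> y" "k0 \<le> j" "j \<le> n" and "0 < a" "a \<le> b" "b < 1"
  shows "emeasure (law q a b (slots x y j n)) (crossing x y k0 n j l) \<le> ennreal ((b / a) powi (- l))"
  using assms(3,2)
proof (induction arbitrary: l rule: inc_induct)
  case base
  have z: "1 \<le> b / a" using assms by simp
  show ?case
  proof (cases "l \<le> 0")
    case True
    have "1 \<le> (b / a) powi (- l)" using True z by (simp add: one_le_power_int)
    then show ?thesis using measure_pmf.emeasure_le_1 order_trans by (metis ennreal_1 ennreal_leI)
  next
    case False
    then have "crossing x y k0 n n l = {}" by (auto simp: crossing_def step_sum_def)
    then show ?thesis by simp
  qed
next
  case (step j)
  have z: "1 \<le> b / a" using assms by simp
  show ?case
  proof (cases "l \<le> 0")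
    case True
    have "1 \<le> (b / a) powi (- l)" using True z by (simp add: one_le_power_int)
    then show ?thesis using measure_pmf.emeasure_le_1 order_trans by (metis ennreal_1 ennreal_leI)
  next
    case False
    have "emeasure (law q a b (slots x y j n)) (crossing x y k0 n j l) =
      emeasure (law q a b (slots x y j n))
      {s. s \<in> crossing x y k0 n (Suc j) (l - (int (s (Suc (x + j), 0)) - int (s (0, y - j))))}"
      using crossing_Suc[OF step.hyps(2)] False by (intro arg_cong2[where f = emeasure]) auto
    also have "\<dots> \<le> ennreal (1 * (b / a) powi (- l) *
        ((1 - a) / (1 - a * (b / a)) * ((1 - b) / (1 - b / (b / a)))))"
    proof (rule emeasure_crossing_step)
      have "b * a < b * 1" using assms by (intro mult_strict_left_mono) auto
      then show "b < b / a" using assms by (simp add: field_simps)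
    qed (use assms step in auto)
    also have "\<dots> = ennreal ((b / a) powi (- l))" using assms by simp
    finally show ?thesis .
  qed
qed

text \<open>Before time \<open>k0\<close> only the square root of the martingale is used, through \<open>min 1 t \<le> sqrt t\<close>;
  its mean decays geometrically.\<close>

lemma emeasure_crossing_drift:
  assumes "n \<le> y" "j \<le> k0" "k0 \<le> n" and "0 < r" "0 < s" "r * exp s < 1"
  defines "a \<equiv> r * exp (- s)" and "b \<equiv> r * exp s"
  shows "emeasure (law q a b (slots x y j n)) (crossing x y k0 n j l) \<le>
    ennreal (((1 - a) * (1 - b) / (1 - r)\<^sup>2) ^ (k0 - j) * exp s powi (- l))"
proof -
  have "1 < exp s" using assms by simp
  have "exp (- s) < 1" using assms by simp
  then have "a < r * 1" unfolding a_def using assms by (intro mult_strict_left_mono)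
  moreover have "r * 1 < b" unfolding b_def using assms by (intro mult_strict_left_mono) auto
  moreover have "0 < a" "b < 1" using assms(4,6) by (auto simp: a_def b_def)
  ultimately have ab: "0 < a" "a \<le> b" "b < 1" "r < 1" by auto
  have ba: "b / a = exp s * exp s"
    using assms by (simp add: a_def b_def exp_minus field_simps)
  have z: "a * exp s = r" "b / exp s = r" by (auto simp: a_def b_def exp_minus)
  show ?thesis
    using assms(2)
  proof (induction arbitrary: l rule: inc_induct)
    case base
    show ?case
    proof (cases "l \<le> 0")
      case True
      have "1 \<le> exp s powi (- l)" using True assms(5) by (simp add: one_le_power_int)
      then show ?thesis using measure_pmf.emeasure_le_1 order_trans by (metis diff_self_eq_0 ennreal_1 ennreal_leI mult_1 power_0)
    next
      case False
      have "emeasure (law q a b (slots x y k0 n)) (crossing x y k0 n k0 l) \<le> ennreal ((b / a) powi (- l))"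
        by (rule emeasure_crossing_martingale) (use assms ab in auto)
      also have "(b / a) powi (- l) \<le> exp s powi (- l)"
      proof -
        have "exp s powi (- l) \<le> 1" using False assms(5) by (simp add: power_int_minus inverse_le_1_iff one_le_power_int)
        then show ?thesis unfolding ba by (simp add: power_int_mult_distrib mult_left_le)
      qed
      finally show ?thesis by (simp add: ennreal_leI)
    qed
  next
    case (step j)
    let ?\<phi> = "(1 - a) * (1 - b) / (1 - r)\<^sup>2"
    have "emeasure (law q a b (slots x y j n)) (crossing x y k0 n j l) =
      emeasure (law q a b (slots x y j n))
      {s. s \<in> crossing x y k0 n (Suc j) (l - (int (s (Suc (x + j), 0)) - int (s (0, y - j))))}"
      using crossing_Suc[of j n _ x y k0 l] step.hyps assms(3) by (intro arg_cong2[where f = emeasure]) auto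
    also have "\<dots> \<le> ennreal (?\<phi> ^ (k0 - Suc j) * exp s powi (- l) *
        ((1 - a) / (1 - a * exp s) * ((1 - b) / (1 - b / exp s))))"
    proof (rule emeasure_crossing_step)
      show "a * exp s < 1" "0 \<le> ?\<phi> ^ (k0 - Suc j)" "a < 1" "0 < b"
        using ab by (simp_all add: z)
      show "b < exp s" using ab(3) \<open>1 < exp s\<close> by (rule order.strict_trans)
    qed (use assms(1,3) ab(1,3) step in auto)
    also have "(1 - a) / (1 - a * exp s) * ((1 - b) / (1 - b / exp s)) = ?\<phi>"
      unfolding z by (simp add: power2_eq_square)
    also have "?\<phi> ^ (k0 - Suc j) * exp s powi (- l) * ?\<phi> = ?\<phi> ^ (k0 - j) * exp s powi (- l)"
    proof -
      have "k0 - j = Suc (k0 - Suc j)" using step.hyps by simp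
      then show ?thesis by (simp only: power_Suc mult_ac)
    qed
    finally show ?case .
  qed
qed

text \<open>The event is determined by the slots of the first \<open>n\<close> steps, so the law on
  the grid restricts to them and the drift bound applies at level 0.\<close>

lemma prob_walk_nonneg:
  assumes "n \<le> y" "x + n \<le> m" "y \<le> m" "k0 \<le> n" and "0 < r" "0 < s" "r * exp s < 1"
  defines "a \<equiv> r * exp (- s)" and "b \<equiv> r * exp s"
  shows "measure_pmf.prob (law q a b (grid m m)) {c. \<exists>k. k0 \<le> k \<and> k \<le> n \<and> 0 \<le> walk c x y k} \<le>
    ((1 - a) * (1 - b) / (1 - r)\<^sup>2) ^ k0"
proof -
  let ?S = "slots x y 0 n"
  have sub: "?S \<subseteq> grid m m" using assms(1-3) by (auto simp: slots_def grid_def)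
  have ab: "a < 1" "b < 1"
    using assms(5-7) by (auto simp: a_def b_def intro: le_less_trans[of _ "r * exp s"])
  have walk: "walk c x y k = step_sum x y 0 k c" for c k
    by (simp add: walk_def step_sum_def atLeast0LessThan)
  have eq: "step_sum x y 0 k (\<lambda>u. if u \<in> ?S then c u else 0) = step_sum x y 0 k c" if "k \<le> n" for c k
    unfolding step_sum_def by (rule sum.cong[OF refl]) (use that in \<open>auto simp: slots_def\<close>)
  have "(\<lambda>u. if u \<in> ?S then c u else 0) \<in> crossing x y k0 n 0 0 \<longleftrightarrow>
      (\<exists>k. k0 \<le> k \<and> k \<le> n \<and> 0 \<le> walk c x y k)" for c
    unfolding crossing_def walk using eq[of _ c] by auto
  then have "{c. \<exists>k. k0 \<le> k \<and> k \<le> n \<and> 0 \<le> walk c x y k} =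
      (\<lambda>c u. if u \<in> ?S then c u else 0) -` crossing x y k0 n 0 0" by auto
  then have "emeasure (law q a b (grid m m)) {c. \<exists>k. k0 \<le> k \<and> k \<le> n \<and> 0 \<le> walk c x y k} =
      emeasure (law q a b ?S) (crossing x y k0 n 0 0)"
    unfolding law_subset[OF finite_grid sub] by simp
  also have "\<dots> \<le> ennreal (((1 - a) * (1 - b) / (1 - r)\<^sup>2) ^ k0)"
    using emeasure_crossing_drift[of n y 0 k0 r s q x 0] assms by simp
  finally show ?thesis
    using ab by (simp add: measure_pmf.emeasure_eq_measure)
qed

section \<open>Exit points\<close>

text \<open>Up to an additive constant, the cumulant generating function of a geometric weight of
  ratio \<open>r\<close>; \<open>psi1\<close>, \<open>psi2\<close> and \<open>psi3\<close> are its
  derivatives.\<close>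

definition psi :: "real \<Rightarrow> real \<Rightarrow> real" where
  "psi r s = - ln (1 - r * exp s)"

definition psi1 :: "real \<Rightarrow> real \<Rightarrow> real" where
  "psi1 r s = r * exp s / (1 - r * exp s)"

definition psi2 :: "real \<Rightarrow> real \<Rightarrow> real" where
  "psi2 r s = r * exp s / (1 - r * exp s)\<^sup>2"

definition psi3 :: "real \<Rightarrow> real \<Rightarrow> real" where
  "psi3 r s = r * exp s * (1 + r * exp s) / (1 - r * exp s) ^ 3"

lemma DERIV_psi:
  assumes "r * exp s < 1"
  shows "(psi r has_real_derivative psi1 r s) (at s)"
    "(psi1 r has_real_derivative psi2 r s) (at s)"
    "(psi2 r has_real_derivative psi3 r s) (at s)"
  unfolding psi_def[abs_def] psi1_def[abs_def] psi2_def[abs_def] psi3_def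
  using assms
  by (auto intro!: derivative_eq_intros simp: divide_simps)
    (auto simp: algebra_simps power2_eq_square power3_eq_cube power4_eq_xxxx)

text \<open>A primitive of the mean \<open>Phi1\<close> of the stationary passage time to
  \<open>(m, n)\<close> with parameters \<open>r * exp (- s)\<close> and \<open>r * exp s\<close>;
  its differences are logarithms of exponential moments.\<close>

definition Phi :: "real \<Rightarrow> nat \<Rightarrow> nat \<Rightarrow> real \<Rightarrow> real" where
  "Phi r m n s = real n * psi r s - real m * psi r (- s)"

definition Phi1 :: "real \<Rightarrow> nat \<Rightarrow> nat \<Rightarrow> real \<Rightarrow> real" where
  "Phi1 r m n s = real n * psi1 r s + real m * psi1 r (- s)"

text \<open>It vanishes when \<open>(m, n)\<close> lies in the characteristic direction of slope
  \<open>s\<close>; a negative value means that \<open>(m, n)\<close> lies to the right of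
  it.\<close>

definition Phi2 :: "real \<Rightarrow> nat \<Rightarrow> nat \<Rightarrow> real \<Rightarrow> real" where
  "Phi2 r m n s = real n * psi2 r s - real m * psi2 r (- s)"

definition Phi3 :: "real \<Rightarrow> nat \<Rightarrow> nat \<Rightarrow> real \<Rightarrow> real" where
  "Phi3 r m n s = real n * psi3 r s + real m * psi3 r (- s)"

lemma DERIV_Phi:
  assumes "r * exp s < 1" "r * exp (- s) < 1"
  shows "(Phi r m n has_real_derivative Phi1 r m n s) (at s)"
    "(Phi1 r m n has_real_derivative Phi2 r m n s) (at s)"
    "(Phi2 r m n has_real_derivative Phi3 r m n s) (at s)"
proof -
  have neg: "((\<lambda>s. f (- s)) has_real_derivative - D) (at s)"
    if "(f has_real_derivative D) (at (- s))" for f :: "real \<Rightarrow> real" and D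
    using DERIV_chain2[where g = uminus, OF that DERIV_minus[OF DERIV_ident]] by simp
  show "(Phi r m n has_real_derivative Phi1 r m n s) (at s)"
    unfolding Phi_def[abs_def] Phi1_def
    using DERIV_diff[OF DERIV_cmult[OF DERIV_psi(1)[OF assms(1)], of "real n"]
        DERIV_cmult[OF neg[OF DERIV_psi(1)[OF assms(2)]], of "real m"]] by simp
  show "(Phi1 r m n has_real_derivative Phi2 r m n s) (at s)"
    unfolding Phi1_def[abs_def] Phi2_def
    using DERIV_add[OF DERIV_cmult[OF DERIV_psi(2)[OF assms(1)], of "real n"]
        DERIV_cmult[OF neg[OF DERIV_psi(2)[OF assms(2)]], of "real m"]] by simp
  show "(Phi2 r m n has_real_derivative Phi3 r m n s) (at s)"
    unfolding Phi2_def[abs_def] Phi3_def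
    using DERIV_diff[OF DERIV_cmult[OF DERIV_psi(3)[OF assms(1)], of "real n"]
        DERIV_cmult[OF neg[OF DERIV_psi(3)[OF assms(2)]], of "real m"]] by simp
qed

text \<open>The two differences bound the log moments of the left and the bottom exit, compared with
  the mean. Their quadratic terms have opposite signs, so a negative \<open>Phi2\<close> favours the
  bottom exit.\<close>

lemma Phi_taylor:
  assumes "\<And>t. \<bar>t\<bar> \<le> s0 \<Longrightarrow> r * exp t < 1" "\<And>t. \<bar>t\<bar> \<le> s0 \<Longrightarrow> Phi3 r m n t \<le> B"
    and "0 < h" "\<bar>s\<bar> \<le> s0"
  shows "\<bar>s + h\<bar> \<le> s0 \<Longrightarrow>
      Phi r m n (s + h) - Phi r m n s - Phi1 r m n s * h \<le> Phi2 r m n s * h\<^sup>2 / 2 + B * h ^ 3 / 6"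
    and "\<bar>s - h\<bar> \<le> s0 \<Longrightarrow>
      Phi r m n s - Phi r m n (s - h) - Phi1 r m n s * h \<le> - Phi2 r m n s * h\<^sup>2 / 2 + B * h ^ 3 / 6"
proof -
  define d where "d k = (if k = 0 then Phi r m n else if k = 1 then Phi1 r m n
    else if k = 2 then Phi2 r m n else Phi3 r m n)" for k :: nat
  have d: "(d k has_real_derivative d (Suc k) t) (at t)" if "k < 3" "- s0 \<le> t" "t \<le> s0" for k t
  proof -
    have "r * exp t < 1" "r * exp (- t) < 1" using that assms(1)[of t] assms(1)[of "- t"] by auto
    note D = DERIV_Phi[OF this, of m n]
    from that(1) have "k = 0 \<or> k = 1 \<or> k = 2" by auto
    then show ?thesis using D by (auto simp: d_def numeral_2_eq_2)
  qed
  have s: "- s0 \<le> s" "s \<le> s0" using assms(4) by auto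
  have T: "\<exists>t. (if u < s then u < t \<and> t < s else s < t \<and> t < u) \<and>
      Phi r m n u = Phi r m n s + Phi1 r m n s * (u - s) + Phi2 r m n s * (u - s)\<^sup>2 / 2 + Phi3 r m n t * (u - s) ^ 3 / 6"
    if "\<bar>u\<bar> \<le> s0" "u \<noteq> s" for u
  proof -
    have "\<exists>t. (if u < s then u < t \<and> t < s else s < t \<and> t < u) \<and>
      Phi r m n u = (\<Sum>k<3. d k s / fact k * (u - s) ^ k) + d 3 t / fact 3 * (u - s) ^ 3"
      by (rule Taylor[of 3 d "Phi r m n" "- s0" s0 s u]) (use s that d in \<open>auto simp: d_def\<close>)
    then show ?thesis by (simp add: d_def eval_nat_numeral numeral_2_eq_2)
  qed
  {
    assume u: "\<bar>s + h\<bar> \<le> s0"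
    from T[OF u] assms(3) obtain t where t: "s < t" "t < s + h"
      "Phi r m n (s + h) = Phi r m n s + Phi1 r m n s * h + Phi2 r m n s * h\<^sup>2 / 2 + Phi3 r m n t * h ^ 3 / 6"
      by auto
    have "Phi3 r m n t * h ^ 3 \<le> B * h ^ 3"
      using assms(2)[of t] t u s assms(3) by (intro mult_right_mono) auto
    with t(3) show "Phi r m n (s + h) - Phi r m n s - Phi1 r m n s * h \<le> Phi2 r m n s * h\<^sup>2 / 2 + B * h ^ 3 / 6"
      by (simp add: field_simps)
  next
    assume u: "\<bar>s - h\<bar> \<le> s0"
    from T[OF u] assms(3) obtain t where t: "s - h < t" "t < s"
      "Phi r m n (s - h) = Phi r m n s - Phi1 r m n s * h + Phi2 r m n s * h\<^sup>2 / 2 - Phi3 r m n t * h ^ 3 / 6"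
      by (auto simp: power3_eq_cube)
    have "Phi3 r m n t * h ^ 3 \<le> B * h ^ 3"
      using assms(2)[of t] t u s assms(3) by (intro mult_right_mono) auto
    with t(3) show "Phi r m n s - Phi r m n (s - h) - Phi1 r m n s * h \<le> - Phi2 r m n s * h\<^sup>2 / 2 + B * h ^ 3 / 6"
      by (simp add: field_simps)
  }
qed

lemma nn_integral_exp_LP:
  assumes "0 < r" and "r * exp s1 < 1" "r * exp (- s1) < 1" "r * exp s2 < 1" "r * exp (- s2) < 1"
  shows "(\<integral>\<^sup>+c. ennreal (exp ((s1 - s2) * real (LP c m n))) \<partial>law (r\<^sup>2) (r * exp (- s1)) (r * exp s2) (grid m n)) =
    ennreal (exp (Phi r m n s1 - Phi r m n s2))"
proof -
  let ?a = "r * exp (- s1)" and ?b = "r * exp s2"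
  have q: "r\<^sup>2 < ?a" "r\<^sup>2 < ?b" using assms by (auto simp: exp_minus power2_eq_square field_simps)
  have z: "r\<^sup>2 / (?a * ?b) = exp (s1 - s2)" "r\<^sup>2 / ?a = r * exp s1" "r\<^sup>2 / ?b = r * exp (- s2)"
    using assms by (auto simp: exp_minus exp_diff power2_eq_square field_simps)
  have "(\<integral>\<^sup>+c. ennreal (exp ((s1 - s2) * real (LP c m n))) \<partial>law (r\<^sup>2) ?a ?b (grid m n)) =
    (\<integral>\<^sup>+c. ennreal ((r\<^sup>2 / (?a * ?b)) ^ LP c m n) \<partial>law (r\<^sup>2) ?a ?b (grid m n))"
    unfolding z by (simp add: exp_of_nat_mult[symmetric] mult.commute)
  also have "\<dots> = ennreal (((1 - ?a) / (1 - r\<^sup>2 / ?b)) ^ m * ((1 - ?b) / (1 - r\<^sup>2 / ?a)) ^ n)"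
    by (rule nn_integral_LP) (use assms q in auto)
  also have "((1 - ?a) / (1 - r\<^sup>2 / ?b)) ^ m * ((1 - ?b) / (1 - r\<^sup>2 / ?a)) ^ n = exp (Phi r m n s1 - Phi r m n s2)"
  proof -
    have e: "exp (psi r s) = 1 / (1 - r * exp s)" if "r * exp s < 1" for s
      using that by (simp add: psi_def exp_minus inverse_eq_divide)
    have "Phi r m n s1 - Phi r m n s2 =
      real m * (psi r (- s2) - psi r (- s1)) + real n * (psi r s1 - psi r s2)"
      by (simp add: Phi_def algebra_simps)
    then show ?thesis
      unfolding z using assms by (simp add: exp_add exp_of_nat_mult exp_diff e)
  qed
  finally show ?thesis .
qed

text \<open>The erased bottom axis may be given slope \<open>s + h\<close>. Restoring its weights
  only increases the passage time, whose moment of order \<open>h\<close> is then explicit.\<close>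

lemma nn_integral_exp_vertical:
  assumes "0 < r" "0 < h" and "r * exp (s + h) < 1" "r * exp (- s - h) < 1" "r * exp s < 1" "r * exp (- s) < 1"
  shows "(\<integral>\<^sup>+c. ennreal (exp (h * real (LP (no_bottom c) m n))) \<partial>law (r\<^sup>2) (r * exp (- s)) (r * exp s) (grid m n))
    \<le> ennreal (exp (Phi r m n (s + h) - Phi r m n s))"
proof -
  let ?p = "\<lambda>a. law (r\<^sup>2) a (r * exp s) (grid m n)"
  have "(\<integral>\<^sup>+c. ennreal (exp (h * real (LP (no_bottom c) m n))) \<partial>?p (r * exp (- s))) =
      (\<integral>\<^sup>+c. ennreal (exp (h * real (LP c m n))) \<partial>map_pmf no_bottom (?p (r * exp (- s))))" by simp
  also have "map_pmf no_bottom (?p (r * exp (- s))) = map_pmf no_bottom (?p (r * exp (- (s + h))))"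
    by (rule no_bottom_indep)
  also have "(\<integral>\<^sup>+c. ennreal (exp (h * real (LP c m n))) \<partial>map_pmf no_bottom (?p (r * exp (- (s + h))))) \<le>
      (\<integral>\<^sup>+c. ennreal (exp ((s + h - s) * real (LP c m n))) \<partial>?p (r * exp (- (s + h))))"
    using assms(2) LP_no_bottom_le by (auto intro!: nn_integral_mono ennreal_leI)
  also have "\<dots> = ennreal (exp (Phi r m n (s + h) - Phi r m n s))"
    by (rule nn_integral_exp_LP) (use assms in auto)
  finally show ?thesis .
qed

text \<open>The mirror image: the erased left axis is given slope \<open>s - h\<close>.\<close>

lemma nn_integral_exp_horizontal:
  assumes "0 < r" "0 < h" and "r * exp (s - h) < 1" "r * exp (h - s) < 1" "r * exp s < 1" "r * exp (- s) < 1"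
  shows "(\<integral>\<^sup>+c. ennreal (exp (h * real (LP (no_left c) m n))) \<partial>law (r\<^sup>2) (r * exp (- s)) (r * exp s) (grid m n))
    \<le> ennreal (exp (Phi r m n s - Phi r m n (s - h)))"
proof -
  let ?p = "\<lambda>b. law (r\<^sup>2) (r * exp (- s)) b (grid m n)"
  have "(\<integral>\<^sup>+c. ennreal (exp (h * real (LP (no_left c) m n))) \<partial>?p (r * exp s)) =
      (\<integral>\<^sup>+c. ennreal (exp (h * real (LP c m n))) \<partial>map_pmf no_left (?p (r * exp s)))" by simp
  also have "map_pmf no_left (?p (r * exp s)) = map_pmf no_left (?p (r * exp (s - h)))"
    by (rule no_left_indep)
  also have "(\<integral>\<^sup>+c. ennreal (exp (h * real (LP c m n))) \<partial>map_pmf no_left (?p (r * exp (s - h)))) \<le>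
      (\<integral>\<^sup>+c. ennreal (exp ((s - (s - h)) * real (LP c m n))) \<partial>?p (r * exp (s - h)))"
    using assms(2) LP_no_left_le by (auto intro!: nn_integral_mono ennreal_leI)
  also have "\<dots> = ennreal (exp (Phi r m n s - Phi r m n (s - h)))"
    by (rule nn_integral_exp_LP) (use assms in auto)
  finally show ?thesis .
qed

lemma pmf_expectation_le:
  assumes "\<And>x. 0 \<le> f x" "(\<integral>\<^sup>+x. ennreal (f x) \<partial>measure_pmf p) \<le> ennreal B" "0 \<le> B"
  shows "integrable (measure_pmf p) f" "measure_pmf.expectation p f \<le> B"
proof -
  show i: "integrable (measure_pmf p) f"
    using assms by (intro integrableI_nonneg) (auto intro: le_less_trans)
  then show "measure_pmf.expectation p f \<le> B"
    using assms nn_integral_eq_integral[of "measure_pmf p" f] by simp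
qed

lemma pmf_Markov:
  fixes f :: "_ \<Rightarrow> real"
  assumes "integrable (measure_pmf p) f" "\<And>x. 0 \<le> f x" "0 < c"
  shows "measure_pmf.prob p {x. c \<le> f x} \<le> measure_pmf.expectation p f / c"
  using integral_Markov_inequality_measure[of "measure_pmf p" f UNIV c] assms by simp

text \<open>The upper tail of \<open>LP\<close> is controlled by the exponential moments of both exits; since the
  mean is known exactly, this also controls the lower tail.\<close>

lemma prob_vertical_exit:
  fixes m n :: nat
  assumes "0 < r" "0 < h" "0 < k" "0 < D"
    and "\<And>t. \<bar>t\<bar> \<le> s0 \<Longrightarrow> r * exp t < 1" "\<bar>s\<bar> \<le> s0" "\<bar>s + h\<bar> \<le> s0" "\<bar>s + k\<bar> \<le> s0" "\<bar>s - k\<bar> \<le> s0"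
  defines "L \<equiv> Phi1 r m n s"
  shows "measure_pmf.prob (law (r\<^sup>2) (r * exp (- s)) (r * exp s) (grid m n))
      {c. LP (no_left c) m n < LP (no_bottom c) m n} \<le>
    (exp (Phi r m n (s + k) - Phi r m n s - L * k) + exp (Phi r m n s - Phi r m n (s - k) - L * k)) / (k * D)
      + exp (Phi r m n (s + h) - Phi r m n s - L * h + D * h)" (is "?P \<le> (?A + ?B) / (k * D) + ?C")
proof -
  let ?p = "law (r\<^sup>2) (r * exp (- s)) (r * exp s) (grid m n)"
  define X V W where "X c = real (LP c m n)" and "V c = real (LP (no_bottom c) m n)"
    and "W c = real (LP (no_left c) m n)" for c
  have X: "X c = max (V c) (W c)" for c
    unfolding X_def V_def W_def LP_max[of c] by simp
  have sm: "r * exp (- s) < 1" "r * exp s < 1" using assms(5)[of "- s"] assms(5)[of s] assms(6) by auto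
  have mean: "integrable (measure_pmf ?p) X" "measure_pmf.expectation ?p X = L"
  proof -
    have *: "r\<^sup>2 = r * exp (- s) * (r * exp s)" by (simp add: exp_minus power2_eq_square)
    show "integrable (measure_pmf ?p) X" unfolding X_def *
      by (rule expectation_LP) (use assms(1) sm in auto)
    show "measure_pmf.expectation ?p X = L" unfolding X_def *
      by (subst expectation_LP) (use assms(1) sm in \<open>auto simp: L_def Phi1_def psi1_def\<close>)
  qed
  have moment: "integrable (measure_pmf ?p) (\<lambda>c. exp (\<kappa> * V c))"
    "measure_pmf.expectation ?p (\<lambda>c. exp (\<kappa> * V c)) \<le> exp (Phi r m n (s + \<kappa>) - Phi r m n s)"
    if "0 < \<kappa>" "\<bar>s + \<kappa>\<bar> \<le> s0" for \<kappa>
    using pmf_expectation_le[OF _ nn_integral_exp_vertical[of r \<kappa> s m n]]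
      assms(5)[of "s + \<kappa>"] assms(5)[of "- s - \<kappa>"] that assms(1) sm unfolding V_def by auto
  have momentW: "integrable (measure_pmf ?p) (\<lambda>c. exp (k * W c))"
    "measure_pmf.expectation ?p (\<lambda>c. exp (k * W c)) \<le> exp (Phi r m n s - Phi r m n (s - k))"
    using pmf_expectation_le[OF _ nn_integral_exp_horizontal[of r k s m n]]
      assms(5)[of "s - k"] assms(5)[of "k - s"] assms(1,3,9) sm unfolding W_def by auto
  \<comment> \<open>\<open>Y\<close> dominates the positive part of \<open>X - L\<close>, through
    \<open>v \<le> exp (k * v) / k\<close> and the bound of the exponential of a maximum by a
    sum.\<close>
  define Y where "Y c = exp (- L * k) / k * (exp (k * V c) + exp (k * W c))" for c
  have Y: "integrable (measure_pmf ?p) Y" "measure_pmf.expectation ?p Y \<le> (?A + ?B) / k"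
  proof -
    show "integrable (measure_pmf ?p) Y" unfolding Y_def using moment(1)[OF assms(3,8)] momentW(1) by auto
    have "measure_pmf.expectation ?p Y = exp (- L * k) / k *
        (measure_pmf.expectation ?p (\<lambda>c. exp (k * V c)) + measure_pmf.expectation ?p (\<lambda>c. exp (k * W c)))"
      unfolding Y_def using moment(1)[OF assms(3,8)] momentW(1) by simp
    also have "\<dots> \<le> exp (- L * k) / k *
        (exp (Phi r m n (s + k) - Phi r m n s) + exp (Phi r m n s - Phi r m n (s - k)))"
      using moment(2)[OF assms(3,8)] momentW(2) assms(3) by (intro mult_left_mono add_mono) auto
    also have "\<dots> = (?A + ?B) / k"
    proof -
      have "exp (- L * k) * exp v = exp (v - L * k)" for v by (simp add: exp_add[symmetric])
      then show ?thesis by (simp add: distrib_left add_divide_distrib)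
    qed
    finally show "measure_pmf.expectation ?p Y \<le> (?A + ?B) / k" .
  qed
  have pos: "max 0 (X c - L) \<le> Y c" for c
  proof -
    have *: "v \<le> exp (k * v) / k" for v
    proof -
      have "k * v \<le> exp (k * v)" using exp_ge_add_one_self[of "k * v"] by linarith
      then show ?thesis using assms(3) by (simp add: field_simps)
    qed
    have "X c - L \<le> exp (k * (X c - L)) / k" by (rule *)
    also have "exp (k * (X c - L)) \<le> exp (k * (V c - L)) + exp (k * (W c - L))"
      unfolding X max_def by simp
    then have "exp (k * (X c - L)) / k \<le> (exp (k * (V c - L)) + exp (k * (W c - L))) / k"
      using assms(3) by (simp add: divide_right_mono)
    also have "\<dots> = Y c"
      by (simp add: Y_def exp_diff exp_minus field_simps)
    finally show ?thesis using assms(3) by (simp add: Y_def)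
  qed
  have int: "integrable (measure_pmf ?p) (\<lambda>c. max 0 (X c - L))" "integrable (measure_pmf ?p) (\<lambda>c. max 0 (L - X c))"
    using mean(1) by auto
  \<comment> \<open>As \<open>X\<close> has mean \<open>L\<close>, the positive and negative parts
    of \<open>X - L\<close> have equal means; this turns the upper tail bound into a lower
    one.\<close>
  have "measure_pmf.expectation ?p (\<lambda>c. max 0 (L - X c)) =
      measure_pmf.expectation ?p (\<lambda>c. max 0 (X c - L) + (L - X c))"
    by (intro Bochner_Integration.integral_cong) auto
  also have "\<dots> = measure_pmf.expectation ?p (\<lambda>c. max 0 (X c - L))"
    using mean int by simp
  also have "\<dots> \<le> measure_pmf.expectation ?p Y"
    by (rule integral_mono[OF int(1) Y(1) pos])
  finally have lower: "measure_pmf.expectation ?p (\<lambda>c. max 0 (L - X c)) \<le> (?A + ?B) / k"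
    using Y(2) by simp
  have "measure_pmf.prob ?p {c. D \<le> max 0 (L - X c)} \<le> measure_pmf.expectation ?p (\<lambda>c. max 0 (L - X c)) / D"
    by (rule pmf_Markov[OF int(2)]) (use assms(4) in auto)
  also have "\<dots> \<le> (?A + ?B) / k / D"
    by (rule divide_right_mono[OF lower]) (use assms(4) in auto)
  finally have 1: "measure_pmf.prob ?p {c. D \<le> max 0 (L - X c)} \<le> (?A + ?B) / (k * D)" by simp
  have "measure_pmf.prob ?p {c. exp (h * (L - D)) \<le> exp (h * V c)} \<le>
      measure_pmf.expectation ?p (\<lambda>c. exp (h * V c)) / exp (h * (L - D))"
    by (rule pmf_Markov[OF moment(1)[OF assms(2,7)]]) auto
  also have "\<dots> \<le> exp (Phi r m n (s + h) - Phi r m n s) / exp (h * (L - D))"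
    using moment(2)[OF assms(2,7)] by (simp add: divide_right_mono)
  also have "\<dots> = ?C" by (simp add: exp_diff[symmetric] algebra_simps)
  finally have 2: "measure_pmf.prob ?p {c. exp (h * (L - D)) \<le> exp (h * V c)} \<le> ?C" .
  \<comment> \<open>If the left exit wins then \<open>X = V\<close>, so either \<open>X\<close> is
    at least \<open>D\<close> below its mean or \<open>V\<close> exceeds
    \<open>L - D\<close>.\<close>
  have "{c. LP (no_left c) m n < LP (no_bottom c) m n} \<subseteq>
      {c. D \<le> max 0 (L - X c)} \<union> {c. exp (h * (L - D)) \<le> exp (h * V c)}"
    using assms(2) by (auto simp: X V_def W_def)
  then have "?P \<le> measure_pmf.prob ?p ({c. D \<le> max 0 (L - X c)} \<union> {c. exp (h * (L - D)) \<le> exp (h * V c)})"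
    by (intro measure_pmf.finite_measure_mono) auto
  also have "\<dots> \<le> measure_pmf.prob ?p {c. D \<le> max 0 (L - X c)} +
      measure_pmf.prob ?p {c. exp (h * (L - D)) \<le> exp (h * V c)}"
    by (rule measure_Un_le) auto
  finally show ?thesis using 1 2 by linarith
qed

lemma psi_bounds:
  assumes "0 < r" "r < 1"
  obtains s0 c C2 C3 where "0 < s0" "0 < c" "0 < C2" "0 < C3"
    and "\<And>t. \<bar>t\<bar> \<le> s0 \<Longrightarrow> r * exp t < 1" "\<And>t. \<bar>t\<bar> \<le> s0 \<Longrightarrow> c \<le> r * exp t"
    and "\<And>t. \<bar>t\<bar> \<le> s0 \<Longrightarrow> c \<le> psi2 r t" "\<And>t. \<bar>t\<bar> \<le> s0 \<Longrightarrow> psi2 r t \<le> C2"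
    and "\<And>t. \<bar>t\<bar> \<le> s0 \<Longrightarrow> 0 \<le> psi3 r t" "\<And>t. \<bar>t\<bar> \<le> s0 \<Longrightarrow> psi3 r t \<le> C3"
proof -
  \<comment> \<open>This \<open>s0\<close> gives \<open>r * exp s0 = sqrt r\<close>, which keeps
    every denominator \<open>1 - r * exp t\<close> away from 0.\<close>
  define \<rho> s0 where "\<rho> = sqrt r" and "s0 = - ln r / 2"
  have \<rho>: "0 < \<rho>" "\<rho> < 1" using assms by (auto simp: \<rho>_def)
  have s0: "0 < s0" using assms by (simp add: s0_def)
  have "exp s0 * exp s0 = 1 / r"
    using assms by (simp add: s0_def exp_add[symmetric] exp_minus inverse_eq_divide)
  then have "(r * exp s0)\<^sup>2 = r" using assms by (simp add: power2_eq_square field_simps)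
  then have e: "r * exp s0 = \<rho>" unfolding \<rho>_def using assms by (metis exp_ge_zero less_eq_real_def mult_nonneg_nonneg real_sqrt_unique)
  have up: "r * exp t \<le> \<rho>" if "\<bar>t\<bar> \<le> s0" for t
    using that assms unfolding e[symmetric] by auto
  have low: "r * exp (- s0) \<le> r * exp t" if "\<bar>t\<bar> \<le> s0" for t
    using that assms by auto
  have pos: "0 < r * exp t" for t using assms by simp
  show thesis
  proof
    show "0 < s0" "0 < r * exp (- s0)" "0 < 1 / (1 - \<rho>)\<^sup>2" "0 < 2 / (1 - \<rho>) ^ 3"
      using s0 assms \<rho> by auto
    fix t assume t: "\<bar>t\<bar> \<le> s0"
    show "r * exp t < 1" using up[OF t] \<rho> by simp
    show "r * exp (- s0) \<le> r * exp t" by (rule low[OF t])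
    define y where "y = r * exp t"
    have y: "0 < y" "y \<le> \<rho>" "r * exp (- s0) \<le> y" using pos up[OF t] low[OF t] by (auto simp: y_def)
    have "y * 1 \<le> y / (1 - y)\<^sup>2" using y \<rho> by (simp add: field_simps power_le_one)
    then show "r * exp (- s0) \<le> psi2 r t" unfolding psi2_def y_def[symmetric] using y by simp
    show "psi2 r t \<le> 1 / (1 - \<rho>)\<^sup>2"
      unfolding psi2_def y_def[symmetric] using y \<rho> by (intro frac_le power_mono) auto
    show "0 \<le> psi3 r t"
      unfolding psi3_def y_def[symmetric] using y \<rho> by simp
    have "y * (1 + y) \<le> 1 * 2" using y \<rho> by (intro mult_mono) auto
    then show "psi3 r t \<le> 2 / (1 - \<rho>) ^ 3"
      unfolding psi3_def y_def[symmetric] using y \<rho> by (intro frac_le power_mono) auto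
  qed
qed

section \<open>Coupling of the stationary model with the model without boundary\<close>

definition bulk :: "nat \<Rightarrow> (nat \<times> nat) set" where
  "bulk m = {1..m} \<times> {1..m}"

lemma law_bulk:
  "map_pmf (no_bottom \<circ> no_left) (law q a b (grid m m)) = Pi_pmf (bulk m) 0 (\<lambda>_. geometric_pmf (1 - q))"
proof -
  have "map_pmf (no_bottom \<circ> no_left) (law q a b (grid m m)) =
      map_pmf (\<lambda>c x. if x \<in> {x. fst x = 0 \<or> snd x = 0} then 0 else c x) (law q a b (grid m m))"
    by (intro map_pmf_cong refl) (auto simp: no_bottom_def no_left_def fun_eq_iff)
  also have "\<dots> = law q a b (grid m m - {x. fst x = 0 \<or> snd x = 0})"
    by (rule law_zero) simp
  also have "grid m m - {x. fst x = 0 \<or> snd x = 0} = bulk m"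
    by (auto simp: grid_def bulk_def)
  also have "law q a b (bulk m) = Pi_pmf (bulk m) 0 (\<lambda>_. geometric_pmf (1 - q))"
    unfolding law_def by (rule Pi_pmf_cong) (auto simp: bulk_def site_def)
  finally show ?thesis .
qed

lemma G_no_boundary: "G (\<lambda>i j. no_bottom (no_left c) (i, j)) i j = G (\<lambda>i j. c (i, j)) i j"
proof -
  have "no_bottom (no_left (no_bottom (no_left c))) = no_bottom (no_left c)"
    by (auto simp: no_bottom_def no_left_def)
  then show ?thesis by (metis LP_no_boundary)
qed

text \<open>The event forced by a maximum of \<open>G\<close> on the antidiagonal at offset
  \<open>u2\<close> or beyond; the weak inequality covers ties.\<close>

definition overtakes :: "(nat \<Rightarrow> nat \<Rightarrow> nat) \<Rightarrow> nat \<Rightarrow> nat \<Rightarrow> nat \<Rightarrow> bool" where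
  "overtakes w N u1 u2 \<longleftrightarrow> (\<exists>v. u2 \<le> v \<and> v < N \<and> G w (N + u1) (N - u1) \<le> G w (N + v) (N - v))"

text \<open>Unless the left exit strictly wins at the base point, the increments of \<open>G\<close>
  to its right are at most those of \<open>LP\<close>, which form the walk. Overtaking then makes
  the walk nonnegative after at least \<open>u2 - u1\<close> steps.\<close>

lemma prob_overtakes:
  fixes N u1 u2 :: nat
  assumes "0 < r" "0 < s" "r * exp s < 1" "u1 < u2" "u2 < N"
  defines "q \<equiv> r\<^sup>2" and "a \<equiv> r * exp (- s)" and "b \<equiv> r * exp s"
  shows "measure_pmf.prob (Pi_pmf (bulk (2 * N - 1)) 0 (\<lambda>_. geometric_pmf (1 - q)))
      {c. overtakes (\<lambda>i j. c (i, j)) N u1 u2} \<le>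
    measure_pmf.prob (law q a b (grid (N + u1) (N - u1)))
      {c. LP (no_left c) (N + u1) (N - u1) < LP (no_bottom c) (N + u1) (N - u1)} +
    ((1 - a) * (1 - b) / (1 - r)\<^sup>2) ^ (u2 - u1)" (is "measure_pmf.prob ?bulk (?E) \<le> measure_pmf.prob ?rect (?X) + ?R")
proof -
  \<comment> \<open>The base point lies on \<open>x + y = 2 * N\<close>, and the staircase inside
    this antidiagonal has size \<open>m = 2 * N - 1\<close>.\<close>
  define m x y where "m = 2 * N - 1" and "x = N + u1" and "y = N - u1"
  let ?p = "law q a b (grid m m)"
  let ?G = "\<lambda>c. G (\<lambda>i j. c (i, j))"
  have xy: "x + y = Suc m" using assms(4,5) by (auto simp: m_def x_def y_def)
  have ab: "0 < a" "a < 1" "0 < b" "b < 1" and q: "q = a * b"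
    using assms(1-3) by (auto simp: a_def b_def q_def exp_minus power2_eq_square field_simps)
      (smt (verit) one_less_exp_iff mult_less_cancel_left2)
  have "measure_pmf.prob ?bulk ?E = measure_pmf.prob ?p ((no_bottom \<circ> no_left) -` ?E)"
    unfolding m_def law_bulk[of q a b, symmetric] by simp
  also have "(no_bottom \<circ> no_left) -` ?E = ?E" by (auto simp: overtakes_def G_no_boundary)
  finally have 1: "measure_pmf.prob ?bulk ?E = measure_pmf.prob ?p ?E" .
  let ?W = "{c. \<exists>k. u2 - u1 \<le> k \<and> k \<le> y - 1 \<and> LP c x y \<le> LP c (x + k) (y - k)}"
  have "?E \<subseteq> ?X \<union> ?W"
  proof
    fix c assume "c \<in> ?E"
    then obtain v where v: "u2 \<le> v" "v < N" "?G c (N + u1) (N - u1) \<le> ?G c (N + v) (N - v)"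
      by (auto simp: overtakes_def)
    define k where "k = v - u1"
    have k: "u2 - u1 \<le> k" "k \<le> y - 1" "k \<le> y" "N + v = x + k" "N - v = y - k"
      using v assms(4) by (auto simp: k_def x_def y_def)
    show "c \<in> ?X \<union> ?W"
    proof (cases "c \<in> ?X")
      case False
      then have "int (?G c (x + k) (y - k)) - int (?G c x y) \<le> int (LP c (x + k) (y - k)) - int (LP c x y)"
        by (intro G_antidiagonal_le) (use k in \<open>auto simp: x_def y_def\<close>)
      then have "LP c x y \<le> LP c (x + k) (y - k)"
        using v(3) unfolding k(4,5) x_def[symmetric] y_def[symmetric] by linarith
      then show ?thesis using k by blast
    qed simp
  qed
  then have "measure_pmf.prob ?p ?E \<le> measure_pmf.prob ?p (?X \<union> ?W)"
    by (intro measure_pmf.finite_measure_mono) auto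
  also have "\<dots> \<le> measure_pmf.prob ?p ?X + measure_pmf.prob ?p ?W"
    by (rule measure_Un_le) auto
  also have "measure_pmf.prob ?p ?X = measure_pmf.prob ?rect ?X"
  proof -
    have sub: "grid x y \<subseteq> grid m m" using assms(4,5) by (auto simp: grid_def x_def y_def m_def)
    let ?res = "\<lambda>c u. if u \<in> grid x y then c u else (0::nat)"
    have "LP (no_left (?res c)) x y = LP (no_left c) x y"
      "LP (no_bottom (?res c)) x y = LP (no_bottom c) x y" for c
      by (rule LP_cong, simp add: no_left_def no_bottom_def grid_def)+
    then have "?X = ?res -` ?X" by (simp add: x_def y_def vimage_def)
    then have "measure_pmf.prob ?p ?X = measure_pmf.prob (map_pmf ?res ?p) ?X"
      by (simp only: measure_map_pmf)
    also have "map_pmf ?res ?p = ?rect"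
      unfolding x_def[symmetric] y_def[symmetric] by (rule law_subset[OF finite_grid sub, symmetric])
    finally show ?thesis .
  qed
  also have "measure_pmf.prob ?p ?W \<le> ?R"
  proof -
    obtain f where f: "\<And>c k. k \<le> y \<Longrightarrow> walk (f c) x y k = int (LP c (x + k) (y - k)) - int (LP c x y)"
      "map_pmf f ?p = ?p"
      using burke_antidiagonal[of m] xy ab unfolding q by metis
    let ?Z = "{c. \<exists>k. u2 - u1 \<le> k \<and> k \<le> y - 1 \<and> 0 \<le> walk c x y k}"
    have "?W = f -` ?Z"
      using f(1) by (auto simp: vimage_def)
    then have "measure_pmf.prob ?p ?W = measure_pmf.prob (map_pmf f ?p) ?Z" by simp
    also have "\<dots> = measure_pmf.prob ?p ?Z" unfolding f(2) ..
    also have "\<dots> \<le> ?R" unfolding a_def b_def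
      by (rule prob_walk_nonneg) (use assms(1-5) in \<open>auto simp: m_def x_def y_def\<close>)
    finally show ?thesis .
  qed
  finally show ?thesis unfolding 1 by simp
qed

text \<open>The parameters balancing the estimates: with \<open>X = N powr (1/3)\<close>, the slope is \<open>s = \<tau> / X\<close>,
  and the base point lies a large multiple of \<open>\<tau> * X\<^sup>2\<close> to the right of the diagonal, beyond the
  characteristic direction of slope \<open>s\<close>.\<close>

lemma G_one_sided_pmf:
  fixes q :: real
  assumes "0 < q" "q < 1"
  obtains A C where "0 < A" "0 < C" and "\<And>\<tau>. 1 \<le> \<tau> \<Longrightarrow> \<exists>N0. \<forall>N\<ge>N0. \<exists>u1 u2. u1 < u2 \<and> u2 < N \<and>
      real u2 \<le> A * \<tau> * real N powr (2 / 3) \<and>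
      measure_pmf.prob (Pi_pmf (bulk (2 * N - 1)) 0 (\<lambda>_. geometric_pmf (1 - q)))
      {c. overtakes (\<lambda>i j. c (i, j)) N u1 u2} \<le> C / \<tau>"
proof -
  define r where "r = sqrt q"
  have r: "0 < r" "r < 1" "r\<^sup>2 = q" using assms by (auto simp: r_def)
  obtain s0 c C2 C3 where s0: "0 < s0" and pos: "0 < c" "0 < C2" "0 < C3"
    and y1: "\<And>t. \<bar>t\<bar> \<le> s0 \<Longrightarrow> r * exp t < 1" and yc: "\<And>t. \<bar>t\<bar> \<le> s0 \<Longrightarrow> c \<le> r * exp t"
    and psi2: "\<And>t. \<bar>t\<bar> \<le> s0 \<Longrightarrow> c \<le> psi2 r t" "\<And>t. \<bar>t\<bar> \<le> s0 \<Longrightarrow> psi2 r t \<le> C2"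
    and psi3: "\<And>t. \<bar>t\<bar> \<le> s0 \<Longrightarrow> 0 \<le> psi3 r t" "\<And>t. \<bar>t\<bar> \<le> s0 \<Longrightarrow> psi3 r t \<le> C3"
    by (fact psi_bounds[OF r(1,2)])
  \<comment> \<open>\<open>A0\<close> makes the part of \<open>Phi2\<close> due to the offset at
    least twice the bound for the part due to the slope, so \<open>Phi2\<close> is negative of order
    \<open>\<tau> * X\<^sup>2\<close>. \<open>B\<close> bounds both exponents at the small scale
    \<open>k\<close>.\<close>
  define A0 B where "A0 = 2 * C3 / c" and "B = C2 * (A0 + 1) + C3 / 3"
  have A0: "0 < A0" using pos by (simp add: A0_def)
  \<comment> \<open>The summands come from the lower tail of the passage time, the upper tail of the
    left exit, and the walk.\<close>
  define C where "C = 6 * exp B / C3 + 3 / C3 + 1 / c"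
  show thesis
  proof
    show "0 < A0 + 3" using A0 by simp
    show "0 < C" using pos by (simp add: C_def add_pos_pos)
    fix \<tau> :: real assume \<tau>: "1 \<le> \<tau>"
    \<comment> \<open>The first entry ensures \<open>u1 + k0 < N\<close>, the second
      \<open>2 * s \<le> s0\<close>, so that the Taylor bound reaches \<open>s + s\<close>.\<close>
    define X0 where "X0 = max ((A0 + 1) * \<tau> + 3) (2 * \<tau> / s0)"
    show "\<exists>N0. \<forall>N\<ge>N0. \<exists>u1 u2. u1 < u2 \<and> u2 < N \<and>
      real u2 \<le> (A0 + 3) * \<tau> * real N powr (2 / 3) \<and>
      measure_pmf.prob (Pi_pmf (bulk (2 * N - 1)) 0 (\<lambda>_. geometric_pmf (1 - q)))
      {c. overtakes (\<lambda>i j. c (i, j)) N u1 u2} \<le> C / \<tau>"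
    proof (rule exI[of _ "nat \<lceil>X0 ^ 3\<rceil>"], intro allI impI)
      fix N :: nat assume "nat \<lceil>X0 ^ 3\<rceil> \<le> N"
      then have N: "X0 ^ 3 \<le> real N" by linarith
      define X where "X = real N powr (1 / 3)"
      have "3 \<le> (A0 + 1) * \<tau> + 3" using A0 \<tau> by simp
      then have X0: "3 \<le> X0" unfolding X0_def by linarith
      then have N1: "0 < real N" using N by (smt (verit) zero_less_power)
      have X3: "X ^ 3 = real N" and X2: "X\<^sup>2 = real N powr (2 / 3)"
        using N1 by (auto simp: X_def powr_powr powr_realpow[symmetric] simp flip: powr_numeral)
      have "X0 \<le> X"
        by (rule power_le_imp_le_base[of _ 2]) (use N X3 in \<open>auto simp: X_def numeral_2_eq_2 numeral_3_eq_3\<close>)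
      then have X: "3 \<le> X" "(A0 + 1) * \<tau> + 3 \<le> X" "2 * \<tau> / s0 \<le> X" using X0 by (auto simp: X0_def)
      have XX: "1 \<le> X\<^sup>2" using X(1) by (simp add: one_le_power)
      define s where "s = \<tau> / X"
      have s: "0 < s" "2 * s \<le> s0" "s \<le> s0" "s < 1" using \<tau> X s0 A0
        by (auto simp: s_def field_simps) (smt (verit) mult_pos_pos)+
      \<comment> \<open>\<open>u1\<close> is the offset of the base point and \<open>k0\<close> the
        number of steps granted to the walk, enough for \<open>s\<^sup>2 * k0\<close> to be at least
        \<open>\<tau> ^ 3\<close>.\<close>
      define u1 k0 where "u1 = nat \<lceil>A0 * \<tau> * X\<^sup>2\<rceil>" and "k0 = nat \<lceil>\<tau> * X\<^sup>2\<rceil>"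
      have t1: "1 \<le> \<tau> * X\<^sup>2" using \<tau> XX mult_mono[of 1 \<tau> 1 "X\<^sup>2"] by simp
      have A0t: "0 \<le> A0 * \<tau> * X\<^sup>2" using A0 \<tau> by simp
      have u1: "A0 * \<tau> * X\<^sup>2 \<le> real u1" "real u1 \<le> A0 * \<tau> * X\<^sup>2 + 1" using A0t by (auto simp: u1_def)
      have k0: "\<tau> * X\<^sup>2 \<le> real k0" "real k0 \<le> \<tau> * X\<^sup>2 + 1" "0 < k0" using t1 by (auto simp: k0_def)
      have "real (u1 + k0) \<le> (A0 + 1) * \<tau> * X\<^sup>2 + 2 * 1" using u1 k0 by (simp add: algebra_simps)
      also have "\<dots> \<le> (A0 + 1) * \<tau> * X\<^sup>2 + 2 * X\<^sup>2" using XX by simp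
      also have "\<dots> = ((A0 + 1) * \<tau> + 2) * X\<^sup>2" by (simp add: algebra_simps)
      also have "\<dots> < X * X\<^sup>2" using X XX by (intro mult_strict_right_mono) auto
      also have "\<dots> = real N" by (simp add: X3[symmetric] power2_eq_square power3_eq_cube)
      finally have u2N: "u1 + k0 < N" by simp
      have "real (u1 + k0) \<le> (A0 + 1) * (\<tau> * X\<^sup>2) + 2 * 1" using u1 k0 by (simp add: algebra_simps)
      also have "\<dots> \<le> (A0 + 1) * (\<tau> * X\<^sup>2) + 2 * (\<tau> * X\<^sup>2)" using t1 by simp
      finally have u2: "real (u1 + k0) \<le> (A0 + 3) * \<tau> * X\<^sup>2" by (simp add: algebra_simps)
      define m n where "m = N + u1" and "n = N - u1"
      have mn: "real m = real N + real u1" "real n = real N - real u1" using u2N by (auto simp: m_def n_def of_nat_diff)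
      have Phi3: "Phi3 r m n t \<le> 2 * real N * C3" if "\<bar>t\<bar> \<le> s0" for t
      proof -
        have "real n * psi3 r t + real m * psi3 r (- t) \<le> real n * C3 + real m * C3"
          using psi3(2)[of t] psi3(2)[of "- t"] that by (intro add_mono mult_left_mono) auto
        then show ?thesis by (simp add: Phi3_def mn algebra_simps)
      qed
      have "\<exists>z. - s < z \<and> z < s \<and> psi2 r s - psi2 r (- s) = (s - (- s)) * psi3 r z"
        by (rule MVT2) (use s y1 in \<open>auto intro!: DERIV_psi(3)\<close>)
      then obtain z where z: "- s < z" "z < s" "psi2 r s - psi2 r (- s) = 2 * s * psi3 r z" by auto
      have diff: "0 \<le> psi2 r s - psi2 r (- s)" "psi2 r s - psi2 r (- s) \<le> 2 * s * C3"
        unfolding z(3) using z s psi3[of z] by auto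
      have Phi2: "Phi2 r m n s = real N * (psi2 r s - psi2 r (- s)) - real u1 * (psi2 r s + psi2 r (- s))"
        by (simp add: Phi2_def mn algebra_simps)
      have Ns: "real N * s = \<tau> * X\<^sup>2" using X by (simp add: s_def X3[symmetric] power2_eq_square power3_eq_cube)
      have Phi2_up: "Phi2 r m n s \<le> - 2 * C3 * (\<tau> * X\<^sup>2)"
      proof -
        have "real N * (psi2 r s - psi2 r (- s)) \<le> real N * (2 * s * C3)"
          using diff by (intro mult_left_mono) auto
        moreover have "A0 * \<tau> * X\<^sup>2 * (c + c) \<le> real u1 * (psi2 r s + psi2 r (- s))"
          using u1 psi2(1)[of s] psi2(1)[of "- s"] s pos A0t by (intro mult_mono add_mono) auto
        moreover have "A0 * \<tau> * X\<^sup>2 * (c + c) = 4 * C3 * (\<tau> * X\<^sup>2)" using pos by (simp add: A0_def)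
        moreover have "real N * (2 * s * C3) = 2 * C3 * (\<tau> * X\<^sup>2)" using Ns by (simp add: algebra_simps)
        ultimately show ?thesis unfolding Phi2 by linarith
      qed
      have Phi2_low: "- Phi2 r m n s \<le> 2 * C2 * (A0 + 1) * (\<tau> * X\<^sup>2)"
      proof -
        have "real u1 * (psi2 r s + psi2 r (- s)) \<le> (A0 + 1) * (\<tau> * X\<^sup>2) * (C2 + C2)"
          using u1 t1 psi2[of s] psi2[of "- s"] s pos A0 \<tau> by (intro mult_mono add_mono) (auto simp: algebra_simps)
        moreover have "0 \<le> real N * (psi2 r s - psi2 r (- s))" using diff by simp
        ultimately show ?thesis unfolding Phi2 by (simp add: algebra_simps)
      qed
      \<comment> \<open>With this \<open>k\<close> both \<open>Phi2 * k\<^sup>2\<close> and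
        \<open>N * k ^ 3\<close> stay bounded, while \<open>k * D\<close> is of order
        \<open>\<tau>\<close>. \<open>D\<close> is small enough to be absorbed by the quadratic gain
        at scale \<open>s\<close>.\<close>
      define k D where "k = 1 / (X * \<tau>)" and "D = C3 * \<tau>\<^sup>2 * X / 3"
      have k: "0 < k" "k \<le> s" using X \<tau> by (auto simp: k_def s_def field_simps) (metis mult_mono' mult_1 order_trans zero_le_one)
      have D: "0 < D" using pos \<tau> X by (simp add: D_def)
      note T = Phi_taylor[of s0 r m n "2 * real N * C3", OF y1 Phi3]
      have "Phi r m n (s + s) - Phi r m n s - Phi1 r m n s * s + D * s \<le>
          - 2 * C3 * (\<tau> * X\<^sup>2) * s\<^sup>2 / 2 + 2 * real N * C3 * s ^ 3 / 6 + D * s"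
        using T(1)[where h = s and s = s] s Phi2_up mult_right_mono[OF Phi2_up, of "s\<^sup>2"] by simp
      \<comment> \<open>The quadratic, cubic and \<open>D\<close> terms are \<open>-1\<close>,
        \<open>1/3\<close> and \<open>1/3\<close> times \<open>C3 * \<tau> ^ 3\<close>.\<close>
      also have "\<dots> = - (C3 * \<tau> ^ 3 / 3)"
        using X by (simp add: s_def D_def X3[symmetric] power2_eq_square power3_eq_cube field_simps)
      also have "exp \<dots> \<le> 3 / (C3 * \<tau>)"
      proof -
        have v: "0 < C3 * \<tau> ^ 3 / 3" using pos \<tau> by simp
        have "exp (- (C3 * \<tau> ^ 3 / 3)) = 1 / exp (C3 * \<tau> ^ 3 / 3)" by (simp add: exp_minus inverse_eq_divide)
        also have "\<dots> \<le> 1 / (C3 * \<tau> / 3)"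
        proof (rule divide_left_mono)
          have "\<tau> * 1 \<le> \<tau> * \<tau>\<^sup>2" using \<tau> by (intro mult_left_mono) auto
          then have "C3 * \<tau> / 3 \<le> C3 * \<tau> ^ 3 / 3" using pos by (simp add: power2_eq_square power3_eq_cube)
          also have "\<dots> \<le> exp (C3 * \<tau> ^ 3 / 3)" using exp_ge_add_one_self[of "C3 * \<tau> ^ 3 / 3"] by linarith
          finally show "C3 * \<tau> / 3 \<le> exp (C3 * \<tau> ^ 3 / 3)" .
        qed (use pos \<tau> in auto)
        finally show ?thesis by simp
      qed
      finally have b1: "exp (Phi r m n (s + s) - Phi r m n s - Phi1 r m n s * s + D * s) \<le> 3 / (C3 * \<tau>)" by simp
      have k3: "2 * real N * C3 * k ^ 3 / 6 \<le> C3 / 3"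
      proof -
        have "2 * real N * C3 * k ^ 3 / 6 = C3 / 3 / \<tau> ^ 3"
          using X by (simp add: k_def X3[symmetric] power3_eq_cube)
        also have "\<dots> \<le> C3 / 3 / 1" using \<tau> pos by (intro divide_left_mono) auto
        finally show ?thesis by simp
      qed
      have "Phi r m n (s + k) - Phi r m n s - Phi1 r m n s * k \<le> Phi2 r m n s * k\<^sup>2 / 2 + 2 * real N * C3 * k ^ 3 / 6"
        using T(1)[where h = k and s = s] s k by simp
      also have "Phi2 r m n s * k\<^sup>2 / 2 \<le> 0"
        using Phi2_up pos t1 by (intro divide_nonpos_pos mult_nonpos_nonneg) (auto intro: order_trans)
      finally have "Phi r m n (s + k) - Phi r m n s - Phi1 r m n s * k \<le> 0 + 2 * real N * C3 * k ^ 3 / 6"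
        by simp
      moreover have "0 \<le> C2 * (A0 + 1)" using pos A0 by simp
      ultimately have "Phi r m n (s + k) - Phi r m n s - Phi1 r m n s * k \<le> B"
        using k3 unfolding B_def by linarith
      moreover have "Phi r m n s - Phi r m n (s - k) - Phi1 r m n s * k \<le> B"
      proof -
        have "Phi r m n s - Phi r m n (s - k) - Phi1 r m n s * k \<le> - Phi2 r m n s * k\<^sup>2 / 2 + 2 * real N * C3 * k ^ 3 / 6"
          using T(2)[where h = k and s = s] s k by simp
        also have "- Phi2 r m n s * k\<^sup>2 / 2 \<le> 2 * C2 * (A0 + 1) * (\<tau> * X\<^sup>2) * k\<^sup>2 / 2"
          using Phi2_low by (intro divide_right_mono mult_right_mono) auto
        also have "\<dots> = C2 * (A0 + 1) / \<tau>"
          using X \<tau> by (simp add: k_def power2_eq_square field_simps)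
        also have "\<dots> \<le> C2 * (A0 + 1) / 1" using \<tau> pos A0 by (intro divide_left_mono) auto
        finally show ?thesis using k3 by (simp add: B_def)
      qed
      ultimately have b2: "(exp (Phi r m n (s + k) - Phi r m n s - Phi1 r m n s * k) +
          exp (Phi r m n s - Phi r m n (s - k) - Phi1 r m n s * k)) / (k * D) \<le> 6 * exp B / C3 / \<tau>"
      proof -
        assume *: "Phi r m n (s + k) - Phi r m n s - Phi1 r m n s * k \<le> B"
          "Phi r m n s - Phi r m n (s - k) - Phi1 r m n s * k \<le> B"
        have kD: "k * D = C3 * \<tau> / 3" using X \<tau> by (simp add: k_def D_def power2_eq_square)
        have "(exp (Phi r m n (s + k) - Phi r m n s - Phi1 r m n s * k) +
          exp (Phi r m n s - Phi r m n (s - k) - Phi1 r m n s * k)) / (k * D) \<le> (exp B + exp B) / (k * D)"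
          using * k D by (intro divide_right_mono add_mono) auto
        then show ?thesis unfolding kD by simp
      qed
      have exit: "measure_pmf.prob (law q (r * exp (- s)) (r * exp s) (grid m n))
          {c. LP (no_left c) m n < LP (no_bottom c) m n} \<le> 6 * exp B / C3 / \<tau> + 3 / (C3 * \<tau>)"
        using prob_vertical_exit[of r s k D s0 s m n, OF r(1) s(1) k(1) D y1] s k b1 b2 r(3) by simp
      have "((1 - r * exp (- s)) * (1 - r * exp s) / (1 - r)\<^sup>2) ^ k0 \<le> 1 / c / \<tau>"
      proof -
        have nn: "0 \<le> (1 - r * exp (- s)) * (1 - r * exp s)" using y1[of s] y1[of "- s"] s by simp
        have "s \<le> exp s - 1" using exp_ge_add_one_self[of s] by linarith
        \<comment> \<open>The numerator of the decay factor falls short of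
          \<open>(1 - r)\<^sup>2\<close> by exactly
          \<open>r * exp (- s) * (exp s - 1)\<^sup>2\<close>, which is of order
          \<open>s\<^sup>2\<close>.\<close>
        then have "c * s\<^sup>2 \<le> r * exp (- s) * (exp s - 1)\<^sup>2"
          using yc[of "- s"] s r by (intro mult_mono power_mono) auto
        also have "\<dots> = (1 - r)\<^sup>2 - (1 - r * exp (- s)) * (1 - r * exp s)"
          by (simp add: power2_eq_square exp_minus field_simps)
        finally have "(1 - r * exp (- s)) * (1 - r * exp s) / (1 - r)\<^sup>2 \<le>
            ((1 - r)\<^sup>2 - c * s\<^sup>2) / (1 - r)\<^sup>2"
          by (intro divide_right_mono) (linarith, simp)
        also have "\<dots> = 1 - c * s\<^sup>2 / (1 - r)\<^sup>2" using r by (simp add: diff_divide_distrib)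
        finally have "(1 - r * exp (- s)) * (1 - r * exp s) / (1 - r)\<^sup>2 \<le> 1 - c * s\<^sup>2 / (1 - r)\<^sup>2" .
        moreover have "c * s\<^sup>2 / 1 \<le> c * s\<^sup>2 / (1 - r)\<^sup>2"
          using r pos by (intro divide_left_mono) (auto simp: power_le_one)
        moreover have "1 - c * s\<^sup>2 \<le> exp (- (c * s\<^sup>2))" using exp_ge_add_one_self[of "- (c * s\<^sup>2)"] by simp
        ultimately have "(1 - r * exp (- s)) * (1 - r * exp s) / (1 - r)\<^sup>2 \<le> exp (- (c * s\<^sup>2))"
          by simp
        then have "((1 - r * exp (- s)) * (1 - r * exp s) / (1 - r)\<^sup>2) ^ k0 \<le> exp (- (c * s\<^sup>2)) ^ k0"
          using nn by (intro power_mono) auto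
        also have "\<dots> = exp (- (c * s\<^sup>2 * real k0))" by (simp add: exp_of_nat_mult[symmetric] mult_ac)
        also have "\<dots> \<le> exp (- (c * \<tau>))"
        proof -
          have "c * \<tau> * 1 \<le> c * \<tau> * \<tau>\<^sup>2" using pos \<tau> by (intro mult_left_mono) auto
          also have "\<dots> = c * s\<^sup>2 * (\<tau> * X\<^sup>2)" using X by (simp add: s_def power2_eq_square)
          also have "\<dots> \<le> c * s\<^sup>2 * real k0" using k0 pos by (intro mult_left_mono) auto
          finally show ?thesis by simp
        qed
        also have "\<dots> = 1 / exp (c * \<tau>)" by (simp add: exp_minus inverse_eq_divide)
        also have "\<dots> \<le> 1 / (c * \<tau>)"
        proof (rule divide_left_mono)
          show "c * \<tau> \<le> exp (c * \<tau>)" using exp_ge_add_one_self[of "c * \<tau>"] by linarith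
        qed (use pos \<tau> in auto)
        finally show ?thesis by simp
      qed
      moreover have "measure_pmf.prob (Pi_pmf (bulk (2 * N - 1)) 0 (\<lambda>_. geometric_pmf (1 - q)))
        {c. overtakes (\<lambda>i j. c (i, j)) N u1 (u1 + k0)} \<le>
        measure_pmf.prob (law q (r * exp (- s)) (r * exp s) (grid m n))
          {c. LP (no_left c) m n < LP (no_bottom c) m n} +
        ((1 - r * exp (- s)) * (1 - r * exp s) / (1 - r)\<^sup>2) ^ k0"
        using prob_overtakes[of r s u1 "u1 + k0" N] r s y1[of s] k0(3) u2N by (simp add: m_def n_def)
      ultimately have "measure_pmf.prob (Pi_pmf (bulk (2 * N - 1)) 0 (\<lambda>_. geometric_pmf (1 - q)))
        {c. overtakes (\<lambda>i j. c (i, j)) N u1 (u1 + k0)} \<le>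
          6 * exp B / C3 / \<tau> + 3 / (C3 * \<tau>) + 1 / c / \<tau>"
        using exit by linarith
      also have "\<dots> = C / \<tau>" using pos \<tau> by (simp add: C_def field_simps)
      finally show "\<exists>u1 u2. u1 < u2 \<and> u2 < N \<and> real u2 \<le> (A0 + 3) * \<tau> * real N powr (2 / 3) \<and>
        measure_pmf.prob (Pi_pmf (bulk (2 * N - 1)) 0 (\<lambda>_. geometric_pmf (1 - q)))
        {c. overtakes (\<lambda>i j. c (i, j)) N u1 u2} \<le> C / \<tau>"
        using u2 u2N k0(3) X2 by (intro exI[of _ u1] exI[of _ "u1 + k0"]) auto
    qed
  qed
qed

section \<open>The leftmost maximum\<close>

lemma G_cong:
  assumes "\<And>a b. 1 \<le> a \<Longrightarrow> a \<le> i \<Longrightarrow> 1 \<le> b \<Longrightarrow> b \<le> j \<Longrightarrow> w a b = w' a b"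
  shows "G w i j = G w' i j"
  using assms by (induction w i j rule: G.induct) auto

lemma G_transpose: "G (\<lambda>i j. w j i) i j = G w j i"
proof (induction "\<lambda>i j. w j i" i j rule: G.induct)
  case (1 j)
  then show ?case by (cases j) auto
qed auto

text \<open>The event depends on finitely many weights, whose joint values form a countable set.
  Summing the point probabilities, products by independence, identifies the measure.\<close>

lemma prob_eq_Pi_pmf:
  fixes w :: "nat \<Rightarrow> nat \<Rightarrow> 'a \<Rightarrow> nat"
  assumes "0 < q" "q < 1" "prob_space M" "0 < m"
    and indep: "prob_space.indep_vars M (\<lambda>_. count_space UNIV) (\<lambda>(i, j). w i j) ({1..} \<times> {1..})"
    and geom: "\<And>i j k. 1 \<le> i \<Longrightarrow> 1 \<le> j \<Longrightarrow> measure M {\<omega> \<in> space M. w i j \<omega> = k} = (1 - q) * q ^ k"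
    and P: "\<And>u v. (\<And>i j. (i, j) \<in> bulk m \<Longrightarrow> u i j = v i j) \<Longrightarrow> P u \<longleftrightarrow> P v"
  shows "{\<omega> \<in> space M. P (\<lambda>i j. w i j \<omega>)} \<in> sets M"
    and "measure M {\<omega> \<in> space M. P (\<lambda>i j. w i j \<omega>)} =
    measure_pmf.prob (Pi_pmf (bulk m) 0 (\<lambda>_. geometric_pmf (1 - q))) {c. P (\<lambda>i j. c (i, j))}"
proof -
  interpret prob_space M by fact
  let ?p = "Pi_pmf (bulk m) 0 (\<lambda>_. geometric_pmf (1 - q))"
  have fin: "finite (bulk m)" and ne: "bulk m \<noteq> {}" using assms(4) by (auto simp: bulk_def)
  have sub: "bulk m \<subseteq> {1..} \<times> {1..}" by (auto simp: bulk_def)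
  let ?w = "\<lambda>x \<omega>. (case x of (i, j) \<Rightarrow> w i j) \<omega>"
  have rv: "?w x \<in> measurable M (count_space UNIV)" if "x \<in> bulk m" for x
    using indep that sub unfolding indep_vars_def by auto
  \<comment> \<open>The value 0 off the bulk matches the default of \<open>Pi_pmf\<close>, so
    \<open>X\<close> takes values in its support.\<close>
  define X where "X \<omega> x = (if x \<in> bulk m then ?w x \<omega> else 0)" for \<omega> x
  have pmf: "pmf ?p c = (\<Prod>x\<in>bulk m. (1 - q) * q ^ c x)" if "\<And>x. x \<notin> bulk m \<Longrightarrow> c x = 0" for c
    using assms(1,2) that by (subst pmf_Pi'[OF fin]) (auto simp: mult.commute)
  have set: "c \<in> set_pmf ?p \<longleftrightarrow> (\<forall>x. x \<notin> bulk m \<longrightarrow> c x = 0)" for c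
  proof
    assume "c \<in> set_pmf ?p"
    from subsetD[OF set_Pi_pmf_subset[OF fin] this] show "\<forall>x. x \<notin> bulk m \<longrightarrow> c x = 0"
      by (simp only: mem_Collect_eq)
  next
    assume *: "\<forall>x. x \<notin> bulk m \<longrightarrow> c x = 0"
    have "pmf ?p c \<noteq> 0" using assms(1,2) fin by (subst pmf) (use * in auto)
    then show "c \<in> set_pmf ?p" by (simp add: set_pmf_eq)
  qed
  have ev: "{\<omega> \<in> space M. X \<omega> = c} = (\<Inter>x\<in>bulk m. ?w x -` {c x} \<inter> space M)" if "c \<in> set_pmf ?p" for c
  proof -
    have "X \<omega> = c \<longleftrightarrow> (\<forall>x\<in>bulk m. ?w x \<omega> = c x)" for \<omega>
    proof
      assume *: "\<forall>x\<in>bulk m. ?w x \<omega> = c x"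
      show "X \<omega> = c"
      proof
        fix x
        show "X \<omega> x = c x" using bspec[OF *, of x] that unfolding set X_def by (cases x, cases "x \<in> bulk m") simp_all
      qed
    qed (auto simp: X_def)
    then show ?thesis using ne by auto
  qed
  have meas: "?w x -` {k} \<inter> space M \<in> sets M" if "x \<in> bulk m" for x k
    using measurable_sets[OF rv[OF that], of "{k}"] by simp
  have prob: "measure M {\<omega> \<in> space M. X \<omega> = c} = pmf ?p c" if c: "c \<in> set_pmf ?p" for c
  proof -
    have "indep_sets (\<lambda>x. {?w x -` A \<inter> space M |A. A \<in> sets (count_space UNIV)}) ({1..} \<times> {1..})"
      using indep unfolding indep_vars_def2 by simp
    then have "prob (\<Inter>x\<in>bulk m. ?w x -` {c x} \<inter> space M) = (\<Prod>x\<in>bulk m. prob (?w x -` {c x} \<inter> space M))"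
      by (rule indep_setsD[OF _ sub ne fin]) auto
    also have "\<dots> = (\<Prod>x\<in>bulk m. (1 - q) * q ^ c x)"
    proof (rule prod.cong[OF refl])
      fix x assume "x \<in> bulk m"
      then obtain i j where x: "x = (i, j)" "1 \<le> i" "1 \<le> j" by (auto simp: bulk_def)
      have "?w x -` {c x} \<inter> space M = {\<omega> \<in> space M. w i j \<omega> = c x}" by (auto simp: x(1))
      then show "prob (?w x -` {c x} \<inter> space M) = (1 - q) * q ^ c x" using geom[OF x(2,3)] by simp
    qed
    also have "\<dots> = pmf ?p c" using c by (subst pmf) (auto simp: set)
    finally show ?thesis unfolding ev[OF c] .
  qed
  let ?I = "{c \<in> set_pmf ?p. P (\<lambda>i j. c (i, j))}"
  have Xset: "X \<omega> \<in> set_pmf ?p" for \<omega> by (auto simp: set X_def)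
  have PX: "P (\<lambda>i j. w i j \<omega>) \<longleftrightarrow> P (\<lambda>i j. X \<omega> (i, j))" for \<omega>
    by (rule P) (auto simp: X_def)
  have Un: "{\<omega> \<in> space M. P (\<lambda>i j. w i j \<omega>)} = (\<Union>c\<in>?I. {\<omega> \<in> space M. X \<omega> = c})"
    using Xset PX by auto
  have sets: "{\<omega> \<in> space M. X \<omega> = c} \<in> sets M" if "c \<in> ?I" for c
    using that by (subst ev, simp) (intro sets.finite_INT fin ne meas)
  have countable: "countable ?I" by (rule countable_subset[OF _ countable_set_pmf[of ?p]]) auto
  show "{\<omega> \<in> space M. P (\<lambda>i j. w i j \<omega>)} \<in> sets M"
    unfolding Un using countable sets by (rule sets.countable_UN'')
  have "emeasure M {\<omega> \<in> space M. P (\<lambda>i j. w i j \<omega>)} =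
      (\<integral>\<^sup>+c. emeasure M {\<omega> \<in> space M. X \<omega> = c} \<partial>count_space ?I)"
    unfolding Un using sets countable
    by (rule emeasure_UN_countable) (auto simp: disjoint_family_on_def)
  also have "\<dots> = (\<integral>\<^sup>+c. ennreal (pmf ?p c) \<partial>count_space ?I)"
    by (rule nn_integral_cong) (simp add: emeasure_eq_measure prob)
  also have "\<dots> = emeasure ?p ?I" by (rule nn_integral_pmf)
  also have "\<dots> = emeasure ?p {c. P (\<lambda>i j. c (i, j))}"
    by (rule emeasure_eq_AE) (auto simp: AE_measure_pmf_iff)
  finally show "measure M {\<omega> \<in> space M. P (\<lambda>i j. w i j \<omega>)} = measure_pmf.prob ?p {c. P (\<lambda>i j. c (i, j))}"
    by (simp add: measure_def)
qed

section \<open>Leftmost maxima over the nodes and their relation to \<open>K\<close>\<close>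

definition nodes :: "nat \<Rightarrow> int set" where
  "nodes N = {- (int N - 1)..int N - 1}"

text \<open>The value type is left open to cover both the real \<open>H_node\<close> and the natural
  number \<open>G\<close>.\<close>

definition leftmost_max :: "nat \<Rightarrow> (int \<Rightarrow> 'b::linorder) \<Rightarrow> int \<Rightarrow> bool" where
  "leftmost_max N f v \<longleftrightarrow> v \<in> nodes N \<and> (\<forall>v'\<in>nodes N. f v' \<le> f v \<and> (v' < v \<longrightarrow> f v' < f v))"

lemma leftmost_max_exists:
  assumes "1 \<le> N"
  shows "\<exists>v. leftmost_max N f v"
proof -
  let ?A = "{v \<in> nodes N. f v = Max (f ` nodes N)}"
  have fin: "finite (nodes N)" and ne: "nodes N \<noteq> {}" using assms by (auto simp: nodes_def)
  have "Max (f ` nodes N) \<in> f ` nodes N" using fin ne by (intro Max_in) auto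
  then have "?A \<noteq> {}" by auto
  then have v: "Min ?A \<in> ?A" using fin by (intro Min_in) auto
  have le: "f v' \<le> f (Min ?A)" if "v' \<in> nodes N" for v' using v that fin by simp
  have "f v' \<noteq> f (Min ?A)" if "v' \<in> nodes N" "v' < Min ?A" for v'
  proof
    assume "f v' = f (Min ?A)"
    with v that have "v' \<in> ?A" by auto
    then have "Min ?A \<le> v'" using fin by (intro Min_le) auto
    with that show False by simp
  qed
  with le v show ?thesis unfolding leftmost_max_def by (intro exI[of _ "Min ?A"]) (auto simp: order.strict_iff_order)
qed

lemma leftmost_max_unique: "leftmost_max N f v \<Longrightarrow> leftmost_max N f v' \<Longrightarrow> v = v'"
  unfolding leftmost_max_def by (metis linorder_neqE not_less)

text \<open>At the nodes the rescaling is an increasing affine function of \<open>G\<close>.\<close>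

lemma leftmost_max_H_node:
  assumes "0 < q" "q < 1" "1 \<le> N"
  shows "leftmost_max N (H_node q w N) v \<longleftrightarrow>
    leftmost_max N (\<lambda>v. G w (nat (int N + v)) (nat (int N - v))) v"
proof -
  define D where "D = d_const q * real N powr (1 / 3)"
  have "0 < D" using assms d_const_pos[of q] by (simp add: D_def)
  then show ?thesis
    unfolding leftmost_max_def H_node_def D_def[symmetric] by (simp add: divide_le_cancel divide_less_cancel)
qed

text \<open>A piecewise linear interpolation attains its supremum at a node. If \<open>u\<close>
  lies to the left of the leftmost maximal node, the supremum up to \<open>u\<close> is strictly
  smaller, so the set defining \<open>K\<close> starts at that node.\<close>

lemma K_eq:
  assumes "0 < q" "q < 1" "1 \<le> N" and v: "leftmost_max N (H_node q w N) v"
  shows "K q w N = mesh q N * of_int v"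
proof -
  define \<mu> h where "\<mu> = mesh q N" and "h = H_node q w N"
  let ?D = "H_dom q N" and ?f = "H q w N"
  have \<mu>: "0 < \<mu>" unfolding \<mu>_def using assms by (intro mesh_pos) auto
  have vn: "v \<in> nodes N" and max: "\<And>v'. v' \<in> nodes N \<Longrightarrow> h v' \<le> h v"
    and less: "\<And>v'. v' \<in> nodes N \<Longrightarrow> v' < v \<Longrightarrow> h v' < h v"
    using v by (auto simp: leftmost_max_def h_def)
  have D: "t \<in> ?D \<longleftrightarrow> - (real N - 1) \<le> t / \<mu> \<and> t / \<mu> \<le> real N - 1" for t
    using \<mu> by (auto simp: H_dom_def \<mu>_def[symmetric] field_simps)
  have f: "?f t = (1 - frac (t / \<mu>)) * h \<lfloor>t / \<mu>\<rfloor> + frac (t / \<mu>) * h (\<lfloor>t / \<mu>\<rfloor> + 1)" for t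
    by (simp add: H_def Let_def \<mu>_def h_def)
  have fl: "\<lfloor>t / \<mu>\<rfloor> \<in> nodes N" if "t \<in> ?D" for t
    using that unfolding D nodes_def atLeastAtMost_iff by linarith
  \<comment> \<open>At the right end of the domain the floor is \<open>N - 1\<close>, and the node
    beyond it enters with weight 0.\<close>
  have fl1: "frac (t / \<mu>) = 0 \<or> \<lfloor>t / \<mu>\<rfloor> + 1 \<in> nodes N" if "t \<in> ?D" for t
  proof (rule disjCI)
    assume "\<lfloor>t / \<mu>\<rfloor> + 1 \<notin> nodes N"
    then have "\<lfloor>t / \<mu>\<rfloor> = int N - 1" using fl[OF that] by (auto simp: nodes_def)
    then have "t / \<mu> = of_int \<lfloor>t / \<mu>\<rfloor>" using that unfolding D by linarith
    then show "frac (t / \<mu>) = 0" by (simp add: frac_def)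
  qed
  have frac: "0 \<le> frac x" "frac x < 1" for x :: real by (auto simp: frac_lt_1)
  have le: "?f t \<le> h v" if "t \<in> ?D" for t
  proof -
    have "frac (t / \<mu>) * h (\<lfloor>t / \<mu>\<rfloor> + 1) \<le> frac (t / \<mu>) * h v"
      using fl1[OF that]
    proof
      assume z: "frac (t / \<mu>) = 0"
      show ?thesis unfolding z by simp
    qed (intro mult_left_mono max frac)
    moreover have "(1 - frac (t / \<mu>)) * h \<lfloor>t / \<mu>\<rfloor> \<le> (1 - frac (t / \<mu>)) * h v"
      using max[OF fl[OF that]] frac(2)[of "t / \<mu>"] by (intro mult_left_mono) auto
    ultimately show ?thesis unfolding f by (simp add: algebra_simps)
  qed
  have vD: "\<mu> * of_int v \<in> ?D" unfolding D using \<mu> vn by (auto simp: nodes_def)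
  have fv: "?f (\<mu> * of_int v) = h v" unfolding f using \<mu> by simp
  have sup: "(SUP t\<in>?D. ?f t) = h v"
    by (rule cSup_eq_maximum) (use vD fv le in \<open>auto intro: image_eqI[of _ _ "\<mu> * of_int v"]\<close>)
  have "(SUP t\<in>{t \<in> ?D. t \<le> u}. ?f t) = h v \<longleftrightarrow> \<mu> * of_int v \<le> u" if u: "u \<in> ?D" for u
  proof
    assume "\<mu> * of_int v \<le> u"
    then show "(SUP t\<in>{t \<in> ?D. t \<le> u}. ?f t) = h v"
      by (intro cSup_eq_maximum) (use vD fv le in \<open>auto intro: image_eqI[of _ _ "\<mu> * of_int v"]\<close>)
  next
    assume eq: "(SUP t\<in>{t \<in> ?D. t \<le> u}. ?f t) = h v"
    show "\<mu> * of_int v \<le> u"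
    proof (rule ccontr)
      assume "\<not> \<mu> * of_int v \<le> u"
      then have uv: "u / \<mu> < of_int v" using \<mu> by (simp add: field_simps)
      define W where "W = {v' \<in> nodes N. v' < v}"
      have "\<lfloor>u / \<mu>\<rfloor> \<in> W" using fl[OF u] uv by (simp add: W_def floor_less_iff)
      then have "W \<noteq> {}" by auto
      moreover have "finite W" unfolding W_def by (rule finite_subset[of _ "nodes N"]) (auto simp: nodes_def)
      ultimately have W: "finite W" "W \<noteq> {}" by simp_all
      define M1 where "M1 = Max (h ` W)"
      have M1: "M1 < h v" using W less by (auto simp: M1_def W_def)
      have hM1: "h v' \<le> M1" if "v' \<in> W" for v' using that W by (simp add: M1_def)
      \<comment> \<open>The largest weight that node \<open>v\<close> receives in the interpolation
        at points up to \<open>u\<close>. As \<open>f0 < 1\<close>, the gap below \<open>h v\<close>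
        is uniform in \<open>t\<close> and survives the supremum.\<close>
      define f0 where "f0 = max 0 (u / \<mu> - (of_int v - 1))"
      have f0: "0 \<le> f0" "f0 < 1" using uv by (auto simp: f0_def)
      have "?f t \<le> M1 + f0 * (h v - M1)" if t: "t \<in> ?D" "t \<le> u" for t
      proof -
        define x where "x = t / \<mu>"
        have x: "x \<le> u / \<mu>" using t \<mu> by (simp add: x_def divide_right_mono)
        have xW: "\<lfloor>x\<rfloor> \<in> W" using fl[OF t(1)] x uv by (simp add: W_def x_def floor_less_iff)
        have f1: "(1 - frac x) * h \<lfloor>x\<rfloor> \<le> (1 - frac x) * M1"
          using hM1[OF xW] frac(2)[of x] by (intro mult_left_mono) auto
        show ?thesis
        proof (cases "\<lfloor>x\<rfloor> + 1 = v")
          case True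
          then have "frac x \<le> f0" using x by (simp add: f0_def frac_def)
          then have "frac x * (h v - M1) \<le> f0 * (h v - M1)" using M1 by (intro mult_right_mono) auto
          then show ?thesis unfolding f x_def[symmetric] True using f1 by (simp add: algebra_simps)
        next
          case False
          have "frac x = 0 \<or> \<lfloor>x\<rfloor> + 1 \<in> W"
            using fl1[OF t(1)] False xW by (auto simp: W_def x_def)
          then have "frac x * h (\<lfloor>x\<rfloor> + 1) \<le> frac x * M1"
          proof
            assume z: "frac x = 0"
            show ?thesis unfolding z by simp
          qed (intro mult_left_mono hM1 frac)
          then have "?f t \<le> M1" unfolding f x_def[symmetric] using f1 by (simp add: algebra_simps)
          moreover have "0 \<le> f0 * (h v - M1)" using f0 M1 by simp
          ultimately show ?thesis by linarith
        qed
      qed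
      then have "(SUP t\<in>{t \<in> ?D. t \<le> u}. ?f t) \<le> M1 + f0 * (h v - M1)"
        using u by (intro cSUP_least) auto
      moreover have "f0 * (h v - M1) < 1 * (h v - M1)" using f0 M1 by (intro mult_strict_right_mono) auto
      ultimately show False using eq by simp
    qed
  qed
  then have "{u \<in> ?D. (SUP t\<in>{t \<in> ?D. t \<le> u}. ?f t) = (SUP t\<in>?D. ?f t)} = {u \<in> ?D. \<mu> * of_int v \<le> u}"
    unfolding sup by auto
  then have "K q w N = Inf {u \<in> ?D. \<mu> * of_int v \<le> u}" by (simp only: K_def)
  also have "\<dots> = \<mu> * of_int v" by (rule cInf_eq_minimum) (use vD in auto)
  finally show ?thesis by (simp add: \<mu>_def)
qed

text \<open>A leftmost maximum at \<open>u2\<close> or beyond would overtake the base point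
  \<open>u1\<close>. Transposing the weights reflects the antidiagonal and excludes the left side in
  the same way.\<close>

lemma abs_K_le:
  assumes "0 < q" "q < 1" "u1 < u2" "u2 < N"
    and "\<not> overtakes w N u1 u2" "\<not> overtakes (\<lambda>i j. w j i) N u1 u2"
  shows "\<bar>K q w N\<bar> \<le> mesh q N * real u2"
proof -
  let ?g = "\<lambda>v. G w (nat (int N + v)) (nat (int N - v))"
  have N: "1 \<le> N" using assms(4) by simp
  obtain v where v: "leftmost_max N ?g v" using leftmost_max_exists[OF N] by blast
  then have K: "K q w N = mesh q N * of_int v"
    using K_eq[OF assms(1,2) N] leftmost_max_H_node[OF assms(1,2) N] by blast
  have vn: "v \<in> nodes N" and max: "\<And>v'. v' \<in> nodes N \<Longrightarrow> ?g v' \<le> ?g v"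
    using v by (auto simp: leftmost_max_def)
  have u1: "int u1 \<in> nodes N" "- int u1 \<in> nodes N" using assms(3,4) by (auto simp: nodes_def)
  have n: "nat (int N + int k) = N + k" "nat (int N - int k) = N - k" for k by auto
  have "v < int u2"
  proof (rule ccontr)
    assume "\<not> v < int u2"
    then obtain k where k: "v = int k" "u2 \<le> k" using nonneg_int_cases[of v] by auto
    have "k < N" using vn k by (auto simp: nodes_def)
    moreover have "G w (N + u1) (N - u1) \<le> G w (N + k) (N - k)"
      using max[OF u1(1)] by (simp add: k(1) n)
    ultimately show False using assms(5) k(2) by (auto simp: overtakes_def)
  qed
  moreover have "- int u2 < v"
  proof (rule ccontr)
    assume "\<not> - int u2 < v"
    then have "v = - int (nat (- v))" "u2 \<le> nat (- v)" by simp_all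
    then obtain k where k: "v = - int k" "u2 \<le> k" by blast
    have "k < N" using vn k by (auto simp: nodes_def)
    moreover have "G w (N - u1) (N + u1) \<le> G w (N - k) (N + k)"
      using max[OF u1(2)] by (simp add: k(1) n)
    moreover have "G (\<lambda>i j. w j i) a b = G w b a" for a b by (rule G_transpose)
    ultimately show False using assms(6) k(2) by (auto simp: overtakes_def)
  qed
  ultimately have "\<bar>of_int v\<bar> \<le> real u2" by linarith
  moreover have "0 < mesh q N" using assms N by (intro mesh_pos) auto
  ultimately show ?thesis unfolding K abs_mult by (intro mult_mono) auto
qed

section \<open>Measurability of \<open>K\<close>\<close>

lemma measurable_count_binop:
  fixes f g :: "'a \<Rightarrow> nat" and h :: "nat \<Rightarrow> nat \<Rightarrow> 'b"
  assumes "f \<in> measurable M (count_space UNIV)" "g \<in> measurable M (count_space UNIV)"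
  shows "(\<lambda>x. h (f x) (g x)) \<in> measurable M (count_space UNIV)"
  by (rule measurable_compose_countable[OF _ assms(1)])
    (rule measurable_compose[OF assms(2)], simp)

text \<open>\<open>K\<close> is a finite sum over the nodes, each term switched on by a condition on
  finitely many measurable passage times.\<close>

lemma K_measurable:
  assumes "0 < q" "q < 1" "1 \<le> N"
    and w: "\<And>i j. 1 \<le> i \<Longrightarrow> 1 \<le> j \<Longrightarrow> w i j \<in> measurable M (count_space UNIV)"
  shows "(\<lambda>\<omega>. K q (\<lambda>i j. w i j \<omega>) N) \<in> borel_measurable M"
proof -
  have G: "(\<lambda>\<omega>. G (\<lambda>i j. w i j \<omega>) i j) \<in> measurable M (count_space UNIV)" for i j
  proof (induction i arbitrary: j)
    case (Suc i)
    then show ?case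
    proof (induction j)
      case (Suc j)
      then show ?case
        unfolding G.simps using w[of "Suc i" "Suc j"]
        by (intro measurable_count_binop[where h = "(+)"] measurable_count_binop[where h = max]) auto
    qed simp
  qed simp
  let ?g = "\<lambda>\<omega> v. G (\<lambda>i j. w i j \<omega>) (nat (int N + v)) (nat (int N - v))"
  have lm: "Measurable.pred M (\<lambda>\<omega>. leftmost_max N (?g \<omega>) v)" for v
  proof -
    have [measurable]: "Measurable.pred M (\<lambda>\<omega>. ?g \<omega> v' \<le> ?g \<omega> v)"
      "Measurable.pred M (\<lambda>\<omega>. ?g \<omega> v' < ?g \<omega> v)" for v'
      using measurable_count_binop[OF G G, where h = "(\<le>)"] measurable_count_binop[OF G G, where h = "(<)"] by auto
    have [simp]: "finite (nodes N)" by (simp add: nodes_def)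
    show ?thesis unfolding leftmost_max_def by measurable
  qed
  have "K q (\<lambda>i j. w i j \<omega>) N = (\<Sum>v\<in>nodes N. if leftmost_max N (?g \<omega>) v then mesh q N * of_int v else 0)" for \<omega>
  proof -
    obtain v where v: "leftmost_max N (?g \<omega>) v" using leftmost_max_exists[OF assms(3)] by blast
    then have iff: "leftmost_max N (?g \<omega>) v' \<longleftrightarrow> v' = v" for v' using leftmost_max_unique by blast
    have "finite (nodes N)" "v \<in> nodes N" using v by (simp_all add: nodes_def leftmost_max_def)
    then have "(\<Sum>v\<in>nodes N. if leftmost_max N (?g \<omega>) v then mesh q N * of_int v else 0) = mesh q N * of_int v"
      unfolding iff by simp
    then show ?thesis
      using K_eq[OF assms(1-3)] leftmost_max_H_node[OF assms(1-3)] v by metis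
  qed
  then show ?thesis using lm by simp
qed

text \<open>Independent, identically distributed weights on a square have a law invariant under
  transposition; this carries the one-sided bound to the other side of the diagonal.\<close>

lemma prob_transpose:
  "measure_pmf.prob (Pi_pmf (bulk m) 0 (\<lambda>_. p)) {c. P (\<lambda>i j. c (j, i))} =
    measure_pmf.prob (Pi_pmf (bulk m) 0 (\<lambda>_. p)) {c. P (\<lambda>i j. c (i, j))}"
proof -
  have "bij_betw prod.swap (bulk m) (bulk m)"
    by (rule bij_betwI[where g = prod.swap]) (auto simp: bulk_def)
  then have "Pi_pmf (bulk m) 0 (\<lambda>_. p) = map_pmf (\<lambda>c. c \<circ> prod.swap) (Pi_pmf (bulk m) 0 (\<lambda>_. p))"
    by (rule Pi_pmf_bij_betw[rotated]) (auto simp: bulk_def)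
  then have "measure_pmf.prob (Pi_pmf (bulk m) 0 (\<lambda>_. p)) {c. P (\<lambda>i j. c (i, j))} =
      measure_pmf.prob (map_pmf (\<lambda>c. c \<circ> prod.swap) (Pi_pmf (bulk m) 0 (\<lambda>_. p))) {c. P (\<lambda>i j. c (i, j))}"
    by (rule arg_cong)
  then show ?thesis by (simp add: vimage_def)
qed

text \<open>For \<open>v < N\<close> both coordinates of \<open>(N + v, N - v)\<close> are at most
  \<open>2 * N - 1\<close>, so the event is determined by the weights in that square.\<close>

lemma overtakes_cong:
  assumes "\<And>i j. (i, j) \<in> bulk (2 * N - 1) \<Longrightarrow> w i j = w' i j" "u1 < N"
  shows "overtakes w N u1 u2 \<longleftrightarrow> overtakes w' N u1 u2"
proof -
  have "G w (N + v) (N - v) = G w' (N + v) (N - v)" if "v < N" for v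
    by (rule G_cong, rule assms(1)) (use that in \<open>auto simp: bulk_def\<close>)
  then show ?thesis using assms(2) unfolding overtakes_def by auto
qed

theorem proposition1p4:
  fixes q :: real and M :: "'a measure" and w :: "nat \<Rightarrow> nat \<Rightarrow> 'a \<Rightarrow> nat"
  assumes "0 < q" and "q < 1"
    and "prob_space M"
    and "prob_space.indep_vars M (\<lambda>_. count_space UNIV) (\<lambda>(i, j). w i j) ({1..} \<times> {1..})"
    and "\<And>i j m. 1 \<le> i \<Longrightarrow> 1 \<le> j \<Longrightarrow> measure M {\<omega> \<in> space M. w i j \<omega> = m} = (1 - q) * q ^ m"
  shows "(\<forall>N\<ge>1. (\<lambda>\<omega>. K q (\<lambda>i j. w i j \<omega>) N) \<in> borel_measurable M) \<and>
    (\<forall>\<epsilon>>0. \<exists>T>0. \<exists>N0. \<forall>N\<ge>N0.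
       measure M {\<omega> \<in> space M. \<bar>K q (\<lambda>i j. w i j \<omega>) N\<bar> > T} < \<epsilon>)"
proof (intro conjI allI impI)
  interpret prob_space M by fact
  have w: "w i j \<in> measurable M (count_space UNIV)" if "1 \<le> i" "1 \<le> j" for i j
    using assms(4) that unfolding indep_vars_def by force
  show "(\<lambda>\<omega>. K q (\<lambda>i j. w i j \<omega>) N) \<in> borel_measurable M" if "1 \<le> N" for N
    using K_measurable[OF assms(1,2) that w] .
  fix \<epsilon> :: real assume \<epsilon>: "0 < \<epsilon>"
  obtain A C where AC: "0 < A" "0 < C" and bound: "\<And>\<tau>. 1 \<le> \<tau> \<Longrightarrow> \<exists>N0. \<forall>N\<ge>N0. \<exists>u1 u2. u1 < u2 \<and> u2 < N \<and>
      real u2 \<le> A * \<tau> * real N powr (2 / 3) \<and>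
      measure_pmf.prob (Pi_pmf (bulk (2 * N - 1)) 0 (\<lambda>_. geometric_pmf (1 - q)))
      {c. overtakes (\<lambda>i j. c (i, j)) N u1 u2} \<le> C / \<tau>"
    by (fact G_one_sided_pmf[OF assms(1,2)])
  \<comment> \<open>Chosen to make \<open>2 * C / \<tau> < \<epsilon>\<close>, one share
    \<open>C / \<tau>\<close> for each side of the diagonal.\<close>
  define \<tau> where "\<tau> = 1 + 2 * C / \<epsilon>"
  have \<tau>: "1 \<le> \<tau>" using AC \<epsilon> by (simp add: \<tau>_def)
  \<comment> \<open>The factor of \<open>N powr (- 2 / 3)\<close> in \<open>mesh\<close>. It cancels
    against the order \<open>N powr (2 / 3)\<close> of \<open>u2\<close>, so the bound
    \<open>\<kappa> * A * \<tau>\<close> on \<open>K\<close> is independent of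
    \<open>N\<close>.\<close>
  define \<kappa> where "\<kappa> = (1 - sqrt q) / (1 + sqrt q) * d_const q"
  have \<kappa>: "0 < \<kappa>" unfolding \<kappa>_def using assms(1,2) d_const_pos[of q]
    by (intro mult_pos_pos divide_pos_pos add_pos_pos) auto
  have small: "2 * (C / \<tau>) < \<epsilon>"
  proof -
    have "2 * C < \<epsilon> * \<tau>" using \<epsilon> AC by (simp add: \<tau>_def distrib_left)
    then show ?thesis using \<tau> by (simp add: field_simps)
  qed
  from bound[OF \<tau>] obtain N0 where N0: "\<And>N. N0 \<le> N \<Longrightarrow> \<exists>u1 u2. u1 < u2 \<and> u2 < N \<and>
      real u2 \<le> A * \<tau> * real N powr (2 / 3) \<and>
      measure_pmf.prob (Pi_pmf (bulk (2 * N - 1)) 0 (\<lambda>_. geometric_pmf (1 - q)))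
      {c. overtakes (\<lambda>i j. c (i, j)) N u1 u2} \<le> C / \<tau>" by blast
  have "measure M {\<omega> \<in> space M. \<bar>K q (\<lambda>i j. w i j \<omega>) N\<bar> > \<kappa> * A * \<tau>} < \<epsilon>" if "N0 \<le> N" for N
  proof -
    from N0[OF that] obtain u1 u2 where u: "u1 < u2" "u2 < N" "real u2 \<le> A * \<tau> * real N powr (2 / 3)"
      and p: "measure_pmf.prob (Pi_pmf (bulk (2 * N - 1)) 0 (\<lambda>_. geometric_pmf (1 - q)))
      {c. overtakes (\<lambda>i j. c (i, j)) N u1 u2} \<le> C / \<tau>" by blast
    define W where "W \<omega> i j = w i j \<omega>" for \<omega> i j
    have m: "0 < 2 * N - 1" using u by simp
    have transfer: "{\<omega> \<in> space M. P (W \<omega>)} \<in> sets M"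
      "measure M {\<omega> \<in> space M. P (W \<omega>)} =
        measure_pmf.prob (Pi_pmf (bulk (2 * N - 1)) 0 (\<lambda>_. geometric_pmf (1 - q))) {c. P (\<lambda>i j. c (i, j))}"
      if "\<And>u v. (\<And>i j. (i, j) \<in> bulk (2 * N - 1) \<Longrightarrow> u i j = v i j) \<Longrightarrow> P u \<longleftrightarrow> P v" for P
      unfolding W_def
      by (rule prob_eq_Pi_pmf[OF assms(1-3) m assms(4)]; use assms(5) that in blast)+
    have cong: "overtakes x N u1 u2 \<longleftrightarrow> overtakes y N u1 u2"
      "overtakes (\<lambda>i j. x j i) N u1 u2 \<longleftrightarrow> overtakes (\<lambda>i j. y j i) N u1 u2"
      if "\<And>i j. (i, j) \<in> bulk (2 * N - 1) \<Longrightarrow> x i j = y i j" for x y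
      by (rule overtakes_cong; use that u in \<open>simp add: bulk_def\<close>)+
    have 1: "{\<omega> \<in> space M. overtakes (W \<omega>) N u1 u2} \<in> sets M"
      "measure M {\<omega> \<in> space M. overtakes (W \<omega>) N u1 u2} \<le> C / \<tau>"
      using transfer[of "\<lambda>w. overtakes w N u1 u2", OF cong(1)] p by simp_all
    have 2: "{\<omega> \<in> space M. overtakes (\<lambda>i j. W \<omega> j i) N u1 u2} \<in> sets M"
      "measure M {\<omega> \<in> space M. overtakes (\<lambda>i j. W \<omega> j i) N u1 u2} \<le> C / \<tau>"
      using transfer[of "\<lambda>w. overtakes (\<lambda>i j. w j i) N u1 u2", OF cong(2)] p
        prob_transpose[where P = "\<lambda>w. overtakes w N u1 u2"] by simp_all
    have mesh: "mesh q N * real u2 \<le> \<kappa> * A * \<tau>"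
    proof -
      have "mesh q N * real u2 \<le> (\<kappa> * real N powr (- 2 / 3)) * (A * \<tau> * real N powr (2 / 3))"
        unfolding mesh_def \<kappa>_def[symmetric] using u \<kappa> by (intro mult_left_mono) auto
      also have "\<dots> = \<kappa> * A * \<tau> * (real N powr (- 2 / 3) * real N powr (2 / 3))" by simp
      also have "real N powr (- 2 / 3) * real N powr (2 / 3) = 1"
        using u by (simp add: powr_add[symmetric])
      finally show ?thesis by simp
    qed
    have "{\<omega> \<in> space M. \<bar>K q (\<lambda>i j. w i j \<omega>) N\<bar> > \<kappa> * A * \<tau>} \<subseteq>
        {\<omega> \<in> space M. overtakes (W \<omega>) N u1 u2} \<union> {\<omega> \<in> space M. overtakes (\<lambda>i j. W \<omega> j i) N u1 u2}"
      using abs_K_le[OF assms(1,2) u(1,2)] mesh unfolding W_def by force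
    then have "measure M {\<omega> \<in> space M. \<bar>K q (\<lambda>i j. w i j \<omega>) N\<bar> > \<kappa> * A * \<tau>} \<le>
        measure M ({\<omega> \<in> space M. overtakes (W \<omega>) N u1 u2} \<union> {\<omega> \<in> space M. overtakes (\<lambda>i j. W \<omega> j i) N u1 u2})"
      using 1(1) 2(1) by (intro finite_measure_mono) auto
    also have "\<dots> \<le> measure M {\<omega> \<in> space M. overtakes (W \<omega>) N u1 u2} +
        measure M {\<omega> \<in> space M. overtakes (\<lambda>i j. W \<omega> j i) N u1 u2}"
      by (rule measure_Un_le) (use 1(1) 2(1) in auto)
    finally show ?thesis using 1(2) 2(2) small by linarith
  qed
  moreover have "0 < \<kappa> * A * \<tau>" using \<kappa> AC \<tau> by simp
  ultimately show "\<exists>T>0. \<exists>N0. \<forall>N\<ge>N0. measure M {\<omega> \<in> space M. \<bar>K q (\<lambda>i j. w i j \<omega>) N\<bar> > T} < \<epsilon>"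
    by blast
qed

end
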